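(* For every integer $k\geq 3$, \[ \frac{Q(k)}{\varphi(k)}=e-\frac{1}{e}+O\left(k^{-1/2}\log\log k\right), \] where the implied constant is absolute. In particular $\lim_{k\to\infty}Q(k)/\varphi(k)=e-1/e$.
   Context: For a real $x\in[e^{-e},e^{1/e}]$, the sequence $x,\ x^x,\ x^{x^x},\ldots$ converges; its limit is denoted $h(x)$, and it satisfies $h(x)=x^{h(x)}$, $1/e\leq h(x)\leq e$. For an algebraic number $A$, $\mathrm{ord}(A):=\min\{n\in\mathbb{N}: A^n\in\mathbb{Q}\}$ if such $n$ exists, and $\infty$ otherwise. $Q(k):=\#\{A\in\mathbb{A}\cap[e^{-e},e^{1/e}] : h(A)\text{ is algebraic and }\mathrm{ord}(A)=k\}$ (this set is finite), where $\mathbb{A}$ is the set of algebraic numbers. $\varphi$ is Euler's totient function. *)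

theory Defs
  imports "HOL-Computational_Algebra.Polynomial" "HOL-Number_Theory.Totient"
          "HOL-Library.Extended_Nat"
begin

fun tower :: "real \<Rightarrow> nat \<Rightarrow> real" where
  "tower x 0 = x"
| "tower x (Suc n) = x powr tower x n"

text \<open>h(x): the limit of the power tower (meaningful for x in [e^-e, e^(1/e)]).\<close>
definition h :: "real \<Rightarrow> real" where
  "h x = lim (tower x)"

definition alg_ord :: "real \<Rightarrow> enat" where
  "alg_ord A = (if \<exists>n::nat. n \<ge> 1 \<and> A ^ n \<in> \<rat>
                then enat (LEAST n::nat. n \<ge> 1 \<and> A ^ n \<in> \<rat>) else \<infinity>)"

definition Q :: "nat \<Rightarrow> nat" where
  "Q k = card {A::real. algebraic A \<and> A \<in> {exp (- exp 1) .. exp (1 / exp 1)}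
                 \<and> algebraic (h A) \<and> alg_ord A = enat k}"

end

(* If A^k is rational and b = h(A) is algebraic, then A powr b = b and hence (A^k) powr b = b^k with a
   rational base, so b is rational by a special case of the Gelfond-Schneider theorem. The coprime pairs
   (m, n) with h(A) = m/n then parametrise the numbers counted by Q(k): A = (m/n) powr (n/m), whose
   order divides m and equals m unless m and n are both g-th powers for some g >= 2 dividing m. Up to
   these exceptions Q(k) counts the n coprime to k in [k/e, e k], which a sieve evaluates as
   totient(k) (e - 1/e) + O(2^omega(k)). The exceptional n = v^g with m = u^g have v < 2 u coprime to u,
   hence number at most 2 totient(u) = 2 totient(m)/u^(g-1), and these sum to O(totient(k)/sqrt k).

   The transcendence step is done over the reals: the pigeonhole principle gives a nonzero exponential
   polynomial F with small integer coefficients and small Taylor coefficients, so F is tiny on a long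
   interval. At the points s + t b its values are rational multiples of integer polynomials in b, so a
   Liouville estimate makes them vanish, and Rolle's theorem bounds the number of real zeros of F. *)

theory Submission
  imports Defs "HOL-Library.FuncSet" "HOL-Real_Asymp.Real_Asymp"
    "HOL-Computational_Algebra.Nth_Powers"
begin

section \<open>Values of integer polynomials at algebraic numbers\<close>

text \<open>In the case of Gelfond-Schneider that occurs here, \<open>a powr x\<close> is an integer
  polynomial in x itself, namely x^k. All values of F at the points s + t x therefore lie in Z[x] up
  to a power of one denominator, and a Liouville inequality for the single number x suffices,
  without a number field holding several algebraic numbers. The inequality must be uniform in the
  degree, which shapes the polynomial estimates.

  Complex proofs pass from few zeros to many by Schwarz's lemma. Here the first M Taylor
  coefficients of F are made small and the tail is compared with the series at twice the radius, so
  F is tiny on the whole interval at once. The parameters give exactly as many points s + t x as F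
  has coefficients, and the strict zero estimate from Rolle's theorem is then contradicted without
  any extrapolation.

  In the counting, both the sieve error 2^omega(k) and the number of exceptional pairs are
  O(totient(k)/sqrt k) with explicit constants. This yields an error O(k^(-1/2)), and ln ln k is
  bounded below by a positive constant for k at least 3.\<close>

definition l1_norm :: "int poly \<Rightarrow> int" where
  "l1_norm p = sum_list (map abs (coeffs p))"

lemma l1_norm_0 [simp]: "l1_norm 0 = 0"
  by (simp add: l1_norm_def)

lemma l1_norm_pCons [simp]: "l1_norm (pCons a p) = \<bar>a\<bar> + l1_norm p"
  by (cases "a = 0 \<and> p = 0") (auto simp: l1_norm_def cCons_def)

lemma l1_norm_nonneg [simp]: "l1_norm p \<ge> 0"
  by (induction p) auto

lemma l1_norm_eq_0_iff [simp]: "l1_norm p = 0 \<longleftrightarrow> p = 0"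
proof (induction p)
  case (pCons a p)
  have "l1_norm p \<ge> 0" by simp
  then show ?case using pCons by (auto simp: add_nonneg_eq_0_iff)
qed simp

lemma l1_norm_ge_1: "p \<noteq> 0 \<Longrightarrow> l1_norm p \<ge> 1"
  using l1_norm_nonneg[of p] l1_norm_eq_0_iff[of p] by linarith

lemma l1_norm_add: "l1_norm (p + q) \<le> l1_norm p + l1_norm q"
proof (induction p q rule: poly_induct2)
  case (pCons a p b q)
  have "\<bar>a + b\<bar> \<le> \<bar>a\<bar> + \<bar>b\<bar>" by simp
  with pCons show ?case by simp
qed simp

lemma l1_norm_smult [simp]: "l1_norm (smult c p) = \<bar>c\<bar> * l1_norm p"
  by (induction p) (auto simp: abs_mult algebra_simps)

lemma l1_norm_minus [simp]: "l1_norm (- p) = l1_norm p"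
  by (induction p) auto

lemma l1_norm_diff: "l1_norm (p - q) \<le> l1_norm p + l1_norm q"
  using l1_norm_add[of p "- q"] by simp

lemma l1_norm_mult: "l1_norm (p * q) \<le> l1_norm p * l1_norm q"
proof (induction p)
  case (pCons a p)
  have "l1_norm (pCons a p * q) \<le> l1_norm (smult a q) + l1_norm (pCons 0 (p * q))"
    using l1_norm_add[of "smult a q" "pCons 0 (p * q)"] by (simp del: l1_norm_smult l1_norm_pCons)
  also have "\<dots> \<le> \<bar>a\<bar> * l1_norm q + l1_norm p * l1_norm q"
    using pCons by simp
  finally show ?case by (simp add: algebra_simps)
qed simp

lemma l1_norm_power: "l1_norm (p ^ n) \<le> l1_norm p ^ n"
proof (induction n)
  case (Suc n)
  have "l1_norm (p ^ Suc n) \<le> l1_norm p * l1_norm (p ^ n)"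
    by (simp add: l1_norm_mult)
  also have "\<dots> \<le> l1_norm p * l1_norm p ^ n"
    using Suc by (intro mult_left_mono) auto
  finally show ?case by simp
qed (simp add: one_pCons)

lemma l1_norm_sum: "l1_norm (sum f I) \<le> (\<Sum>i\<in>I. l1_norm (f i))"
proof (induction I rule: infinite_finite_induct)
  case (insert i I)
  then show ?case using l1_norm_add[of "f i" "sum f I"] by simp
qed auto

lemma l1_norm_monom [simp]: "l1_norm (monom c n) = \<bar>c\<bar>"
  by (induction n) (auto simp: monom_0 monom_Suc)

lemma abs_lead_coeff_le_l1_norm: "\<bar>lead_coeff p\<bar> \<le> l1_norm p"
proof (induction p)
  case (pCons a p)
  then show ?case using l1_norm_nonneg[of p] by (cases "p = 0") auto
qed simp

section \<open>Evaluation of integer polynomials and Liouville's inequality\<close>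

definition int_poly_eval :: "int poly \<Rightarrow> real \<Rightarrow> real" where
  "int_poly_eval p x = poly (map_poly of_int p) x"

lemma int_poly_eval_0 [simp]: "int_poly_eval 0 x = 0"
  by (simp add: int_poly_eval_def)

lemma int_poly_eval_pCons [simp]: "int_poly_eval (pCons a p) x = of_int a + x * int_poly_eval p x"
  by (simp add: int_poly_eval_def map_poly_pCons)

lemma int_poly_eval_add [simp]: "int_poly_eval (p + q) x = int_poly_eval p x + int_poly_eval q x"
  by (induction p q rule: poly_induct2) (auto simp: algebra_simps)

lemma int_poly_eval_smult [simp]: "int_poly_eval (smult c p) x = of_int c * int_poly_eval p x"
  by (induction p) (auto simp: algebra_simps)

lemma int_poly_eval_mult [simp]: "int_poly_eval (p * q) x = int_poly_eval p x * int_poly_eval q x"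
  by (induction p) (auto simp: algebra_simps)

lemma int_poly_eval_power [simp]: "int_poly_eval (p ^ n) x = int_poly_eval p x ^ n"
  by (induction n) (auto simp: one_pCons)

lemma int_poly_eval_sum: "int_poly_eval (sum f I) x = (\<Sum>i\<in>I. int_poly_eval (f i) x)"
  by (induction I rule: infinite_finite_induct) auto

lemma abs_int_poly_eval_le:
  fixes x b :: real
  assumes "\<bar>x\<bar> \<le> b" "b \<ge> 1" "degree p \<le> n"
  shows "\<bar>int_poly_eval p x\<bar> \<le> of_int (l1_norm p) * b ^ n"
  using assms(3)
proof (induction p arbitrary: n)
  case (pCons a p)
  show ?case
  proof (cases "p = 0")
    case True
    have "\<bar>of_int a\<bar> * 1 \<le> \<bar>of_int a :: real\<bar> * b ^ n"
      using assms(2) by (intro mult_left_mono one_le_power) auto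
    with True show ?thesis by simp
  next
    case False
    with pCons.prems obtain k where n: "n = Suc k" "degree p \<le> k"
      by (cases n) auto
    have "\<bar>x * int_poly_eval p x\<bar> \<le> b * (of_int (l1_norm p) * b ^ k)"
      unfolding abs_mult using assms pCons.IH[OF n(2)] by (intro mult_mono) auto
    moreover have "\<bar>of_int a\<bar> \<le> \<bar>of_int a :: real\<bar> * b ^ n"
      using assms by (simp add: mult_le_cancel_left1 one_le_power)
    ultimately have "\<bar>of_int a + x * int_poly_eval p x\<bar>
        \<le> \<bar>of_int a :: real\<bar> * b ^ n + b * (of_int (l1_norm p) * b ^ k)"
      by linarith
    then show ?thesis by (simp add: n algebra_simps)
  qed
qed simp

text \<open>Each division step over the integers multiplies the dividend by
  \<open>lead_coeff g\<close>. The new dividend has norm at most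
  \<open>2 * l1_norm g * l1_norm f\<close>; the third copy in the factor 3 pays for the monomial
  added to the quotient. \<open>n\<close> only bounds the number of steps: the factor
  \<open>lead_coeff g\<close> is applied even when nothing is left to divide.\<close>

lemma pseudo_division_l1_norm:
  fixes f g :: "int poly"
  assumes "degree g > 0" "degree f < n + degree g"
  shows "\<exists>q r. smult (lead_coeff g ^ n) f = q * g + r \<and> degree r < degree g \<and> degree q \<le> n
           \<and> l1_norm r \<le> (3 * l1_norm g) ^ n * l1_norm f
           \<and> l1_norm q \<le> (3 * l1_norm g) ^ n * l1_norm f"
  using assms(2)
proof (induction n arbitrary: f)
  case 0
  then show ?case by (intro exI[of _ 0] exI[of _ f]) auto
next
  case (Suc n)
  have g: "l1_norm g \<ge> 1" using assms by (intro l1_norm_ge_1) auto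
  show ?case
  proof (cases "degree f < degree g")
    case True
    have "\<bar>lead_coeff g ^ Suc n\<bar> \<le> (3 * l1_norm g) ^ Suc n"
      unfolding power_abs using abs_lead_coeff_le_l1_norm[of g] g
      by (intro power_mono) linarith+
    then show ?thesis
      using True by (intro exI[of _ 0] exI[of _ "smult (lead_coeff g ^ Suc n) f"])
        (use g in \<open>auto intro!: mult_right_mono\<close>)
  next
    case False
    define k where "k = degree f - degree g"
    define t where "t = monom (lead_coeff f) k"
    define f1 where "f1 = smult (lead_coeff g) f - t * g"
    have f: "f \<noteq> 0" "degree f > 0" using False assms(1) by auto
    have "degree (t * g) = degree f"
      using False f assms(1) by (subst degree_mult_eq) (auto simp: t_def degree_monom_eq k_def)
    have "coeff (t * g) (degree f) = lead_coeff g * lead_coeff f"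
      using \<open>degree (t * g) = degree f\<close> lead_coeff_mult[of t g]
      by (simp add: t_def lead_coeff_monom mult.commute del: coeff_monom)
    then have cf: "coeff f1 (degree f) = 0"
      by (simp add: f1_def)
    have df: "degree f1 \<le> degree f"
      unfolding f1_def using \<open>degree (t * g) = degree f\<close>
      by (intro degree_diff_le) (auto intro: degree_smult_le)
    have "degree f1 < degree f"
    proof (rule ccontr)
      assume "\<not> ?thesis"
      with df have "degree f1 = degree f" by simp
      with cf have "f1 = 0" by (metis leading_coeff_0_iff)
      with \<open>degree f1 = degree f\<close> f show False by simp
    qed
    then have "degree f1 < n + degree g" using Suc.prems by simp
    from Suc.IH[OF this] obtain q r where qr:
      "smult (lead_coeff g ^ n) f1 = q * g + r" "degree r < degree g" "degree q \<le> n"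
      "l1_norm r \<le> (3 * l1_norm g) ^ n * l1_norm f1"
      "l1_norm q \<le> (3 * l1_norm g) ^ n * l1_norm f1" by blast
    have nf1: "l1_norm f1 \<le> 2 * l1_norm g * l1_norm f"
    proof -
      have "l1_norm f1 \<le> \<bar>lead_coeff g\<bar> * l1_norm f + l1_norm (t * g)"
        unfolding f1_def using l1_norm_diff[of "smult (lead_coeff g) f" "t * g"] by simp
      also have "l1_norm (t * g) \<le> \<bar>lead_coeff f\<bar> * l1_norm g"
        using l1_norm_mult[of t g] by (simp add: t_def)
      also have "\<bar>lead_coeff f\<bar> * l1_norm g \<le> l1_norm f * l1_norm g"
        by (intro mult_right_mono abs_lead_coeff_le_l1_norm) auto
      also have "\<bar>lead_coeff g\<bar> * l1_norm f \<le> l1_norm g * l1_norm f"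
        by (intro mult_right_mono abs_lead_coeff_le_l1_norm) auto
      finally show ?thesis by (simp add: mult_ac)
    qed
    define T where "T = (3 * l1_norm g) ^ n * (l1_norm g * l1_norm f)"
    have "(3 * l1_norm g) ^ n * l1_norm f1 \<le> (3 * l1_norm g) ^ n * (2 * l1_norm g * l1_norm f)"
      using nf1 g by (intro mult_left_mono) auto
    then have step: "(3 * l1_norm g) ^ n * l1_norm f1 \<le> 2 * T" by (simp add: T_def mult_ac)
    have T: "0 \<le> T" "(3 * l1_norm g) ^ Suc n * l1_norm f = 3 * T" using g by (simp_all add: T_def)
    have tn: "l1_norm (smult (lead_coeff g ^ n) t) \<le> T"
    proof -
      have "\<bar>lead_coeff g ^ n\<bar> \<le> (3 * l1_norm g) ^ n"
        unfolding power_abs using abs_lead_coeff_le_l1_norm[of g] g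
        by (intro power_mono) linarith+
      moreover have "\<bar>lead_coeff f\<bar> \<le> l1_norm g * l1_norm f"
        using abs_lead_coeff_le_l1_norm[of f] mult_right_mono[OF g, of "l1_norm f"] by simp
      ultimately show ?thesis using g by (auto simp: t_def T_def intro!: mult_mono)
    qed
    have "smult (lead_coeff g ^ Suc n) f = (q + smult (lead_coeff g ^ n) t) * g + r"
    proof -
      have "smult (lead_coeff g) f = f1 + t * g" by (simp add: f1_def)
      then have "smult (lead_coeff g ^ Suc n) f = smult (lead_coeff g ^ n) (f1 + t * g)"
        by (metis power_Suc2 smult_smult)
      also have "\<dots> = q * g + r + smult (lead_coeff g ^ n) (t * g)"
        by (simp add: qr(1) smult_add_right)
      finally show ?thesis by (simp add: algebra_simps)
    qed
    moreover have "degree (q + smult (lead_coeff g ^ n) t) \<le> Suc n"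
    proof -
      have "degree t \<le> Suc n"
        using degree_monom_le[of "lead_coeff f" k] Suc.prems False by (simp add: t_def k_def)
      then show ?thesis using qr(3) by (intro degree_add_le order.trans[OF degree_smult_le]) auto
    qed
    moreover have "l1_norm r \<le> (3 * l1_norm g) ^ Suc n * l1_norm f"
      unfolding T(2) using qr(4) step T(1) by linarith
    moreover have "l1_norm (q + smult (lead_coeff g ^ n) t) \<le> (3 * l1_norm g) ^ Suc n * l1_norm f"
      unfolding T(2) using qr(5) step tn l1_norm_add[of q "smult (lead_coeff g ^ n) t"]
      by linarith
    ultimately show ?thesis using qr(2) by blast
  qed
qed

text \<open>A Euclidean argument takes the place of conjugates and resultants. Dividing a multiple
  of \<open>m\<close> by \<open>g\<close> and evaluating at the root \<open>x\<close> shows that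
  q(x) g(x) and r(x) agree up to sign, with \<open>r\<close> of smaller degree. The lower bound for
  r(x) and the trivial upper bound for q(x) give a lower bound for g(x). The constants grow with
  every degree, but there are fewer than \<open>degree m\<close> of them.\<close>

lemma linear_form_lower_bound:
  fixes x :: real and m :: "int poly"
  assumes m: "int_poly_eval m x = 0" "m \<noteq> 0" "e < degree m"
    and minimal: "\<And>p :: int poly. int_poly_eval p x = 0 \<Longrightarrow> p \<noteq> 0 \<Longrightarrow> degree m \<le> degree p"
  shows "\<exists>C\<ge>1. \<exists>K. \<forall>r. r \<noteq> 0 \<longrightarrow> degree r \<le> e \<longrightarrow>
           1 \<le> \<bar>int_poly_eval r x\<bar> * C * of_int (l1_norm r) ^ K"
  using assms(3)
proof (induction e)
  case 0
  have "1 \<le> \<bar>int_poly_eval r x\<bar> * 1 * of_int (l1_norm r) ^ 0"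
    if r: "r \<noteq> 0" "degree r \<le> 0" for r
  proof -
    obtain a where "r = [:a:]" using r(2) by (auto elim: degree_eq_zeroE)
    with r(1) show ?thesis by simp
  qed
  then show ?case by (intro exI[of _ 1] exI[of _ 0] conjI) (auto simp del: power_0)
next
  case (Suc e)
  then obtain C K where C: "C \<ge> 1" and
    IH: "\<And>r. r \<noteq> 0 \<Longrightarrow> degree r \<le> e \<Longrightarrow>
           1 \<le> \<bar>int_poly_eval r x\<bar> * C * of_int (l1_norm r) ^ K" by auto
  define D where "D = degree m"
  define b where "b = max 1 \<bar>x\<bar>"
  define \<mu> where "\<mu> = real_of_int (l1_norm m)"
  have b: "b \<ge> 1" "\<bar>x\<bar> \<le> b" by (auto simp: b_def)
  have \<mu>: "\<mu> \<ge> 1" using l1_norm_ge_1[OF m(2)] by (simp add: \<mu>_def)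
  define C' where "C' = 3 ^ D * \<mu> * b ^ D * C * (3 ^ D * \<mu>) ^ K"
  have C'_ge: "C' \<ge> C"
  proof -
    have "1 \<le> 3 ^ D * \<mu> * b ^ D * (3 ^ D * \<mu>) ^ K"
      by (intro mult_ge1_I one_le_power \<mu> b) auto
    then have "C * 1 \<le> C * (3 ^ D * \<mu> * b ^ D * (3 ^ D * \<mu>) ^ K)"
      using C by (intro mult_left_mono) auto
    then show ?thesis by (simp add: C'_def mult_ac)
  qed
  define K' where "K' = D + D * K"
  have "1 \<le> \<bar>int_poly_eval g x\<bar> * C' * of_int (l1_norm g) ^ K'"
    if g: "g \<noteq> 0" "degree g \<le> Suc e" for g
  proof -
    define G where "G = real_of_int (l1_norm g)"
    have G: "G \<ge> 1" using l1_norm_ge_1[OF g(1)] by (simp add: G_def)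
    show ?thesis
    proof (cases "degree g \<le> e")
      case True
      have "1 \<le> \<bar>int_poly_eval g x\<bar> * C * G ^ K"
        using IH[OF g(1) True] by (simp add: G_def)
      also have "\<dots> \<le> \<bar>int_poly_eval g x\<bar> * C' * G ^ K'"
        using C C'_ge G Suc.prems
        by (intro mult_mono power_increasing) (auto simp: K'_def D_def trans_le_add2)
      finally show ?thesis by (simp add: G_def)
    next
      case False
      then have dg: "degree g = Suc e" using g(2) by simp
      have "degree m < D + degree g" using dg by (simp add: D_def)
      from pseudo_division_l1_norm[OF _ this] dg obtain q r where qr:
        "smult (lead_coeff g ^ D) m = q * g + r" "degree r < degree g" "degree q \<le> D"
        "l1_norm r \<le> (3 * l1_norm g) ^ D * l1_norm m"
        "l1_norm q \<le> (3 * l1_norm g) ^ D * l1_norm m" by auto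
      have "int_poly_eval (smult (lead_coeff g ^ D) m) x = 0"
        using m(1) by simp
      then have qx: "int_poly_eval q x * int_poly_eval g x + int_poly_eval r x = 0"
        unfolding qr(1) by simp
      \<comment> \<open>A zero remainder would make q(x) g(x) = 0 with both degrees below
        \<open>degree m\<close>, against minimality.\<close>
      have "r \<noteq> 0"
      proof
        assume "r = 0"
        have "smult (lead_coeff g ^ D) m \<noteq> 0" using m(2) g(1) by simp
        then have q0: "q \<noteq> 0" using qr(1) \<open>r = 0\<close> by auto
        have "degree (q * g) = degree m" using qr(1) \<open>r = 0\<close> g(1)
          by (metis add.right_neutral degree_smult_eq leading_coeff_0_iff power_eq_0_iff)
        then have "degree q + Suc e = degree m"
          using q0 g(1) dg by (simp add: degree_mult_eq)
        then have "int_poly_eval q x \<noteq> 0"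
          using minimal[of q] q0 by auto
        moreover have "int_poly_eval g x \<noteq> 0"
          using minimal[of g] g(1) dg Suc.prems by auto
        ultimately show False using qx \<open>r = 0\<close> by simp
      qed
      then have "1 \<le> \<bar>int_poly_eval r x\<bar> * C * of_int (l1_norm r) ^ K"
        using qr(2) dg by (intro IH) auto
      also have "\<bar>int_poly_eval r x\<bar> = \<bar>int_poly_eval q x\<bar> * \<bar>int_poly_eval g x\<bar>"
        using qx by (simp add: abs_mult[symmetric] eq_neg_iff_add_eq_0[symmetric])
      also have "\<dots> * C * of_int (l1_norm r) ^ K
         \<le> ((3 * G) ^ D * \<mu> * b ^ D) * \<bar>int_poly_eval g x\<bar> * C * ((3 * G) ^ D * \<mu>) ^ K"
      proof -
        have "real_of_int (l1_norm r) \<le> (3 * G) ^ D * \<mu>"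
          using of_int_le_iff[where 'a = real, THEN iffD2, OF qr(4)] by (simp add: G_def \<mu>_def)
        moreover have "\<bar>int_poly_eval q x\<bar> \<le> (3 * G) ^ D * \<mu> * b ^ D"
        proof -
          have "\<bar>int_poly_eval q x\<bar> \<le> of_int (l1_norm q) * b ^ D"
            using b qr(3) by (intro abs_int_poly_eval_le)
          also have "real_of_int (l1_norm q) \<le> (3 * G) ^ D * \<mu>"
            using of_int_le_iff[where 'a = real, THEN iffD2, OF qr(5)] by (simp add: G_def \<mu>_def)
          finally show ?thesis using b by (simp add: mult_right_mono)
        qed
        ultimately show ?thesis using C G \<mu> b
          by (intro mult_mono power_mono mult_nonneg_nonneg) auto
      qed
      also have "\<dots> = \<bar>int_poly_eval g x\<bar> * C' * G ^ K'"
        by (simp add: C'_def K'_def power_add power_mult_distrib power_mult[symmetric] mult_ac)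
      finally show ?thesis by (simp add: G_def)
    qed
  qed
  then show ?case using C C'_ge by (intro exI[of _ C'] exI[of _ K'] conjI) auto
qed

text \<open>The degree of \<open>p\<close> enters only as an exponent of \<open>C\<close>, and
  \<open>K\<close> depends on \<open>x\<close> alone; both matter later, where the degrees are of
  order \<open>N ^ 6\<close>. Pseudo-division by an integer annihilator \<open>m\<close> of least
  degree multiplies the value at \<open>x\<close> by a power of \<open>lead_coeff m\<close> and
  leaves a remainder of degree below \<open>degree m\<close>, to which the previous bound applies
  with fixed constants.\<close>

lemma liouville_polynomial_bound:
  fixes x :: real
  assumes "algebraic x"
  shows "\<exists>C\<ge>1. \<exists>K. \<forall>p. int_poly_eval p x \<noteq> 0 \<longrightarrow>
           1 \<le> \<bar>int_poly_eval p x\<bar> * C ^ Suc (degree p) * of_int (l1_norm p) ^ K"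
proof -
  define A where "A = {p :: int poly. p \<noteq> 0 \<and> int_poly_eval p x = 0}"
  obtain p :: "real poly" where p: "\<And>i. coeff p i \<in> \<int>" "p \<noteq> 0" "poly p x = 0"
    using algebraicE[OF assms] by blast
  define p' where "p' = map_poly floor p"
  have "map_poly of_int p' = p"
    using p(1) by (intro poly_eqI) (simp add: p'_def coeff_map_poly)
  then have "p' \<in> A" using p(2,3) by (auto simp: A_def int_poly_eval_def)
  then obtain m where m: "m \<in> A" "\<And>p. p \<in> A \<Longrightarrow> degree m \<le> degree p"
    using arg_min_natI[of "\<lambda>p. p \<in> A" p' degree] arg_min_nat_le[of "\<lambda>p. p \<in> A" _ degree] by metis
  have m0: "m \<noteq> 0" "int_poly_eval m x = 0" using m(1) by (auto simp: A_def)
  have D: "degree m > 0"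
  proof (rule ccontr)
    assume "\<not> ?thesis"
    then obtain a where "m = [:a:]" by (auto elim: degree_eq_zeroE)
    then show False using m0 by simp
  qed
  obtain C K where C: "C \<ge> 1" and low: "\<And>r. r \<noteq> 0 \<Longrightarrow> degree r < degree m \<Longrightarrow>
           1 \<le> \<bar>int_poly_eval r x\<bar> * C * of_int (l1_norm r) ^ K"
    using linear_form_lower_bound[OF m0(2,1), of "degree m - 1"] m(2) D
    by (auto simp: A_def less_eq_Suc_le[symmetric] Suc_le_eq) (metis Suc_pred less_Suc_eq_le)
  define \<mu> where "\<mu> = real_of_int (l1_norm m)"
  have \<mu>: "\<mu> \<ge> 1" using l1_norm_ge_1[OF m0(1)] by (simp add: \<mu>_def)
  define C' where "C' = \<mu> * C * (3 * \<mu>) ^ K"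
  have C': "C' \<ge> 1" unfolding C'_def using \<mu> C by (intro mult_ge1_I one_le_power) auto
  have "1 \<le> \<bar>int_poly_eval p x\<bar> * C' ^ Suc (degree p) * of_int (l1_norm p) ^ K"
    if p: "int_poly_eval p x \<noteq> 0" for p
  proof -
    define n where "n = Suc (degree p)"
    have "degree p < n + degree m" by (simp add: n_def)
    from pseudo_division_l1_norm[OF D this] obtain q r where qr:
      "smult (lead_coeff m ^ n) p = q * m + r" "degree r < degree m" "degree q \<le> n"
      "l1_norm r \<le> (3 * l1_norm m) ^ n * l1_norm p" by blast
    have "int_poly_eval (smult (lead_coeff m ^ n) p) x = int_poly_eval r x"
      unfolding qr(1) using m0 by simp
    then have rx: "of_int (lead_coeff m ^ n) * int_poly_eval p x = int_poly_eval r x"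
      by simp
    then have "r \<noteq> 0" using p m0 by auto
    then have "1 \<le> \<bar>int_poly_eval r x\<bar> * C * of_int (l1_norm r) ^ K"
      using qr(2) by (rule low)
    also have "\<dots> \<le> (\<mu> ^ n * \<bar>int_poly_eval p x\<bar>) * C ^ n * ((3 * \<mu>) ^ n * of_int (l1_norm p)) ^ K"
    proof (intro mult_mono power_mono)
      have "\<bar>real_of_int (lead_coeff m)\<bar> ^ n \<le> \<mu> ^ n"
        using of_int_le_iff[where 'a = real, THEN iffD2, OF abs_lead_coeff_le_l1_norm[of m]]
        by (intro power_mono) (auto simp: \<mu>_def)
      then show "\<bar>int_poly_eval r x\<bar> \<le> \<mu> ^ n * \<bar>int_poly_eval p x\<bar>"
        unfolding rx[symmetric] by (simp add: abs_mult power_abs mult_right_mono)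
      show "C \<le> C ^ n" using C power_increasing[of 1 n C] by (simp add: n_def)
      show "real_of_int (l1_norm r) \<le> (3 * \<mu>) ^ n * of_int (l1_norm p)"
        using of_int_le_iff[where 'a = real, THEN iffD2, OF qr(4)] by (simp add: \<mu>_def)
    qed (use C \<mu> in auto)
    also have "\<dots> = \<bar>int_poly_eval p x\<bar> * C' ^ n * of_int (l1_norm p) ^ K"
      by (simp add: C'_def power_mult_distrib power_mult[symmetric] mult_ac)
    finally show ?thesis by (simp add: n_def)
  qed
  with C' show ?thesis by blast
qed

section \<open>Zeros of exponential polynomials\<close>

text \<open>The bound \<open>y < Max Z\<close> strengthens the induction: the next Rolle point lies
  to the right of the largest of the other zeros and hence differs from all points found
  before.\<close>

lemma rolle_finite_zeros:
  fixes f f' :: "real \<Rightarrow> real"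
  assumes "finite Z" "card Z = Suc n"
    and deriv: "\<And>x. (f has_real_derivative f' x) (at x)"
    and zero: "\<And>z. z \<in> Z \<Longrightarrow> f z = 0"
  shows "\<exists>Y. finite Y \<and> card Y = n \<and> (\<forall>y\<in>Y. f' y = 0 \<and> y < Max Z)"
  using assms(1,2,4)
proof (induction n arbitrary: Z)
  case 0
  then show ?case by (intro exI[of _ "{}"]) auto
next
  case (Suc n)
  define b where "b = Max Z"
  define Z' where "Z' = Z - {b}"
  have Zne: "Z \<noteq> {}" using Suc.prems(2) by auto
  have b: "b \<in> Z" unfolding b_def using Suc.prems(1) Zne by (rule Max_in)
  have Z': "finite Z'" "card Z' = Suc n" "\<And>z. z \<in> Z' \<Longrightarrow> f z = 0"
    using Suc.prems b by (simp_all add: Z'_def)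
  then have "Z' \<noteq> {}" by auto
  obtain Y where Y: "finite Y" "card Y = n" "\<forall>y\<in>Y. f' y = 0 \<and> y < Max Z'"
    using Suc.IH[OF Z'] by blast
  define a where "a = Max Z'"
  have a: "a \<in> Z'" unfolding a_def using Z'(1) \<open>Z' \<noteq> {}\<close> by (rule Max_in)
  have "a < b"
    using a Suc.prems(1) Max_ge[of Z a] by (auto simp: Z'_def b_def less_le)
  moreover have "f a = f b" using a b Suc.prems(3) by (auto simp: Z'_def)
  ultimately obtain z where z: "a < z" "z < b" "DERIV f z :> 0"
    using Rolle[of a b f] DERIV_continuous_on[OF has_field_derivative_at_within[OF deriv]]
      deriv[THEN real_differentiable_def[THEN iffD2, OF exI]] by blast
  have "f' z = 0" using z(3) deriv DERIV_unique by blast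
  moreover have "z \<notin> Y" using Y(3) z(1) by (auto simp: a_def)
  ultimately show ?case using Y z \<open>a < b\<close>
    by (intro exI[of _ "insert z Y"]) (auto simp: a_def b_def)
qed

text \<open>Induction on the total number of coefficients. The factor
  \<open>exp (- \<omega> w * x)\<close> keeps the zeros and turns the term of \<open>w\<close> into
  a plain polynomial. Differentiation then takes one coefficient from it and none from the others,
  whose exponents stay nonzero. Counting by \<open>length (coeffs _)\<close> gives degree plus one,
  and 0 for the zero polynomial.\<close>

lemma exponential_polynomial_zeros:
  fixes P :: "'a \<Rightarrow> real poly" and \<omega> :: "'a \<Rightarrow> real"
  assumes "finite W" "inj_on \<omega> W" "finite Z" "\<exists>w\<in>W. P w \<noteq> 0"
    and "\<And>z. z \<in> Z \<Longrightarrow> (\<Sum>w\<in>W. poly (P w) z * exp (\<omega> w * z)) = 0"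
  shows "card Z < (\<Sum>w\<in>W. length (coeffs (P w)))"
proof -
  define n where "n = (\<Sum>w\<in>W. length (coeffs (P w)))"
  have "card Z < n"
    using n_def assms(3-)
  proof (induction n arbitrary: P Z)
    case 0
    then show ?case using assms(1) by auto
  next
    case (Suc n)
    obtain w where w: "w \<in> W" "P w \<noteq> 0" using Suc.prems by blast
    define P' where "P' = (\<lambda>v. pderiv (P v) + smult (\<omega> v - \<omega> w) (P v))"
    define F where "F = (\<lambda>x. \<Sum>v\<in>W. poly (P v) x * exp ((\<omega> v - \<omega> w) * x))"
    define F' where "F' = (\<lambda>x. \<Sum>v\<in>W. poly (P' v) x * exp ((\<omega> v - \<omega> w) * x))"
    have F_shift: "(\<Sum>v\<in>W. poly (R v) x * exp ((\<omega> v - \<omega> w) * x))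
        = exp (- \<omega> w * x) * (\<Sum>v\<in>W. poly (R v) x * exp (\<omega> v * x))" for R x
      by (simp add: sum_distrib_left exp_add[symmetric] exp_diff exp_minus field_simps)
    have len_w: "length (coeffs (P w)) = Suc (length (coeffs (P' w)))"
    proof (cases "degree (P w) = 0")
      case True
      then have "pderiv (P w) = 0" by (simp add: pderiv_eq_0_iff)
      then show ?thesis using True w by (simp add: P'_def length_coeffs_degree)
    next
      case False
      then have "pderiv (P w) \<noteq> 0" by (simp add: pderiv_eq_0_iff)
      then show ?thesis using False w by (simp add: P'_def length_coeffs_degree degree_pderiv)
    qed
    have len_v: "length (coeffs (P' v)) = length (coeffs (P v))" if v: "v \<in> W" "v \<noteq> w" for v
    proof -
      have \<omega>: "\<omega> v \<noteq> \<omega> w" using inj_onD[OF assms(2)] v w(1) by blast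
      show ?thesis
      proof (cases "degree (P v) = 0")
        case True
        then have "pderiv (P v) = 0" by (simp add: pderiv_eq_0_iff)
        then show ?thesis using \<omega> by (cases "P v = 0") (simp_all add: P'_def length_coeffs_degree)
      next
        case False
        have "degree (P' v) = degree (P v)"
          unfolding P'_def using \<omega> False by (subst degree_add_eq_right) (simp_all add: degree_pderiv)
        moreover have "P v \<noteq> 0" "P' v \<noteq> 0" using False calculation by auto
        ultimately show ?thesis by (simp add: length_coeffs_degree)
      qed
    qed
    have n: "n = (\<Sum>v\<in>W. length (coeffs (P' v)))"
    proof -
      have "(\<Sum>v\<in>W - {w}. length (coeffs (P' v))) = (\<Sum>v\<in>W - {w}. length (coeffs (P v)))"
        by (intro sum.cong) (auto simp: len_v)
      then show ?thesis using Suc.prems(1) len_w w(1) assms(1)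
        by (simp add: sum.remove[of W w])
    qed
    show ?case
    proof (cases "card Z")
      case 0
      then show ?thesis by simp
    next
      case (Suc k)
      have deriv: "(F has_real_derivative F' x) (at x)" for x
        unfolding F_def F'_def P'_def
        by (auto intro!: derivative_eq_intros sum.cong simp: algebra_simps)
      have "F z = 0" if "z \<in> Z" for z
        unfolding F_def F_shift using Suc.prems(4)[OF that] by simp
      from rolle_finite_zeros[OF \<open>finite Z\<close> Suc deriv this] obtain Y where
        Y: "finite Y" "card Y = k" "\<forall>y\<in>Y. F' y = 0" by blast
      have Y0: "(\<Sum>v\<in>W. poly (P' v) z * exp (\<omega> v * z)) = 0" if "z \<in> Y" for z
        using Y(3) that unfolding F'_def F_shift by simp
      show ?thesis
      proof (cases "\<exists>v\<in>W. P' v \<noteq> 0")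
        case True
        from Suc.IH[OF n Y(1) True Y0] show ?thesis using Suc Y by simp
      next
        \<comment> \<open>The derivative has no coefficients left, so the sum is a nonzero constant
          times one exponential and cannot vanish at a point of \<open>Z\<close>.\<close>
        case False
        have "P v = 0" if "v \<in> W - {w}" for v
          using len_v[of v] False that by auto
        then have eq: "(\<Sum>v\<in>W. poly (P v) z * exp (\<omega> v * z)) = poly (P w) z * exp (\<omega> w * z)" for z
          using w(1) assms(1) by (simp add: sum.remove[of W w])
        obtain z where z: "z \<in> Z" using Suc by fastforce
        have "P' w = 0" using False w(1) by blast
        then have "pderiv (P w) = 0" by (simp add: P'_def)
        then obtain c where "P w = [:c:]" by (auto simp: pderiv_eq_0_iff elim: degree_eq_zeroE)
        then show ?thesis using Suc.prems(4)[OF z] w(2) unfolding eq by simp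
      qed
    qed
  qed
  then show ?thesis by (simp add: n_def)
qed

section \<open>The Gelfond-Schneider theorem for a positive rational base\<close>

text \<open>Among the \<open>(H + 1) ^ card I\<close> vectors with entries in 0..H, two have all
  their forms in the same cells of width \<epsilon>, and their difference is the solution. Each form
  lies between -Y and Y and so meets at most 2 Y / \<epsilon> + 2 cells.\<close>

lemma dirichlet_pigeonhole:
  fixes a :: "'j \<Rightarrow> 'i \<Rightarrow> real" and B \<epsilon> :: real and H :: nat
  assumes fin: "finite I" "finite J" and \<epsilon>: "\<epsilon> > 0"
    and bound: "\<And>i j. i \<in> I \<Longrightarrow> j \<in> J \<Longrightarrow> \<bar>a j i\<bar> \<le> B"
    and less: "(2 * card I * H * B / \<epsilon> + 2) ^ card J < (real H + 1) ^ card I"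
  shows "\<exists>p :: 'i \<Rightarrow> int. (\<exists>i\<in>I. p i \<noteq> 0) \<and> (\<forall>i\<in>I. \<bar>p i\<bar> \<le> int H)
           \<and> (\<forall>j\<in>J. \<bar>\<Sum>i\<in>I. of_int (p i) * a j i\<bar> \<le> \<epsilon>)"
proof -
  define Y where "Y = card I * H * B"
  define X where "X = (I \<rightarrow>\<^sub>E {0..int H})"
  define u where "u = (\<lambda>p j. \<Sum>i\<in>I. real_of_int (p i) * a j i)"
  define cell where "cell = (\<lambda>p :: 'i \<Rightarrow> int. \<lambda>j\<in>J. \<lfloor>u p j / \<epsilon>\<rfloor>)"
  define V where "V = (J \<rightarrow>\<^sub>E {\<lfloor>- Y / \<epsilon>\<rfloor>..\<lfloor>Y / \<epsilon>\<rfloor>})"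
  have u: "\<bar>u p j\<bar> \<le> Y" if p: "p \<in> X" and j: "j \<in> J" for p j
  proof -
    have "\<bar>u p j\<bar> \<le> (\<Sum>i\<in>I. \<bar>real_of_int (p i) * a j i\<bar>)"
      unfolding u_def by (rule sum_abs)
    also have "\<dots> \<le> (\<Sum>i\<in>I. real H * B)"
    proof (intro sum_mono)
      fix i assume i: "i \<in> I"
      then have "p i \<in> {0..int H}" using p by (auto simp: X_def PiE_iff)
      then have "\<bar>real_of_int (p i)\<bar> \<le> real H" by auto
      then show "\<bar>real_of_int (p i) * a j i\<bar> \<le> real H * B"
        unfolding abs_mult using bound[OF i j] by (intro mult_mono) auto
    qed
    finally show ?thesis by (simp add: Y_def)
  qed
  have maps: "cell \<in> X \<rightarrow> V"
  proof
    fix p assume p: "p \<in> X"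
    have "\<lfloor>- Y / \<epsilon>\<rfloor> \<le> \<lfloor>u p j / \<epsilon>\<rfloor>" "\<lfloor>u p j / \<epsilon>\<rfloor> \<le> \<lfloor>Y / \<epsilon>\<rfloor>" if "j \<in> J" for j
      using u[OF p that] \<epsilon> by (intro floor_mono divide_right_mono; linarith)+
    then show "cell p \<in> V" by (auto simp: cell_def V_def)
  qed
  have "real (card V) < real (card X)"
  proof -
    have "real (card {\<lfloor>- Y / \<epsilon>\<rfloor>..\<lfloor>Y / \<epsilon>\<rfloor>}) \<le> max 0 (2 * Y / \<epsilon> + 2)"
    proof -
      define z where "z = \<lfloor>Y / \<epsilon>\<rfloor> + 1 - \<lfloor>- Y / \<epsilon>\<rfloor>"
      have "real_of_int z \<le> 2 * Y / \<epsilon> + 2" unfolding z_def by linarith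
      then have "real (nat z) \<le> max 0 (2 * Y / \<epsilon> + 2)" by (cases "z \<ge> 0") auto
      then show ?thesis by (simp add: z_def)
    qed
    moreover have "Y \<ge> 0" if "J \<noteq> {}"
    proof (cases "I = {}")
      case False
      with that obtain i j where "i \<in> I" "j \<in> J" by blast
      then have "B \<ge> 0" using bound by (meson abs_ge_zero order.trans)
      then show ?thesis by (simp add: Y_def)
    qed (simp add: Y_def)
    ultimately have "real (card {\<lfloor>- Y / \<epsilon>\<rfloor>..\<lfloor>Y / \<epsilon>\<rfloor>}) \<le> 2 * Y / \<epsilon> + 2" if "J \<noteq> {}"
      using that \<epsilon> by (simp add: max_def)
    then have "real (card V) \<le> (2 * Y / \<epsilon> + 2) ^ card J"
      using fin unfolding V_def
      by (cases "J = {}") (auto simp: card_PiE simp del: card_atLeastAtMost_int intro!: power_mono)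
    also have "\<dots> < real (card X)"
      using less fin by (simp add: X_def card_PiE Y_def mult_ac add_ac)
    finally show ?thesis .
  qed
  moreover have "finite X" "finite V" using fin by (auto simp: X_def V_def intro!: finite_PiE)
  ultimately have "\<not> inj_on cell X"
    using card_inj_on_le[of cell X V] maps by (auto simp: image_subset_iff_funcset)
  then obtain p q where pq: "p \<in> X" "q \<in> X" "p \<noteq> q" "cell p = cell q"
    by (auto simp: inj_on_def)
  show ?thesis
  proof (intro exI[of _ "\<lambda>i. p i - q i"] conjI ballI)
    show "\<exists>i\<in>I. p i - q i \<noteq> 0"
      using pq(1-3) unfolding X_def by (metis PiE_ext right_minus_eq)
    show "\<bar>p i - q i\<bar> \<le> int H" if "i \<in> I" for i
    proof -
      have "p i \<in> {0..int H}" "q i \<in> {0..int H}"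
        using pq(1,2) that by (auto simp: X_def PiE_iff)
      then show ?thesis by auto
    qed
    show "\<bar>\<Sum>i\<in>I. of_int (p i - q i) * a j i\<bar> \<le> \<epsilon>" if "j \<in> J" for j
    proof -
      have "\<lfloor>u p j / \<epsilon>\<rfloor> = \<lfloor>u q j / \<epsilon>\<rfloor>"
        using fun_cong[OF pq(4), of j] that by (simp add: cell_def)
      then have "\<bar>u p j / \<epsilon> - u q j / \<epsilon>\<bar> \<le> 1" by linarith
      then have "\<bar>u p j - u q j\<bar> \<le> \<epsilon>"
        using \<epsilon> by (simp add: diff_divide_distrib[symmetric] field_simps)
      then show ?thesis by (simp add: u_def sum_subtractf algebra_simps)
    qed
  qed
qed

section \<open>Taylor coefficients of x^i exp(d x) and the auxiliary function\<close>

definition monomial_exp_coeff :: "nat \<Rightarrow> real \<Rightarrow> nat \<Rightarrow> real" where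
  "monomial_exp_coeff i d n = (if n < i then 0 else d ^ (n - i) / fact (n - i))"

lemma monomial_exp_sums: "(\<lambda>n. monomial_exp_coeff i d n * x ^ n) sums (x ^ i * exp (d * x))"
proof -
  have "(\<lambda>n. (d * x) ^ n /\<^sub>R fact n) sums exp (d * x)"
    by (rule exp_converges)
  from sums_mult[OF this, of "x ^ i"]
  have "(\<lambda>n. monomial_exp_coeff i d (n + i) * x ^ (n + i)) sums (x ^ i * exp (d * x))"
    by (simp add: monomial_exp_coeff_def power_mult_distrib power_add divide_inverse mult_ac)
  then show ?thesis
    by (subst (asm) sums_iff_shift) (simp add: monomial_exp_coeff_def)
qed

lemma abs_monomial_exp_coeff: "\<bar>monomial_exp_coeff i d n\<bar> = monomial_exp_coeff i \<bar>d\<bar> n"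
  by (simp add: monomial_exp_coeff_def power_abs)

text \<open>With \<bar>d\<bar> and \<open>R\<close> in place of \<open>d\<close> and the argument,
  all terms of the series are nonnegative, so a single one is at most the sum. This serves as
  Cauchy's estimate.\<close>

lemma monomial_exp_term_le:
  assumes "R \<ge> 0"
  shows "\<bar>monomial_exp_coeff i d n\<bar> * R ^ n \<le> R ^ i * exp (\<bar>d\<bar> * R)"
proof -
  have "(\<Sum>k\<in>{n}. monomial_exp_coeff i \<bar>d\<bar> k * R ^ k) \<le> R ^ i * exp (\<bar>d\<bar> * R)"
    using assms unfolding sums_unique[OF monomial_exp_sums[of i "\<bar>d\<bar>" R]]
    by (intro sum_le_suminf sums_summable[OF monomial_exp_sums])
       (auto simp: monomial_exp_coeff_def)
  then show ?thesis by (simp add: abs_monomial_exp_coeff)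
qed

text \<open>Comparison with the majorant series at radius \<open>2 * R\<close>: every term from
  index \<open>M\<close> on loses a factor of at least \<open>2 ^ M\<close>. This is the gain that
  complex proofs take from Schwarz's lemma.\<close>

lemma monomial_exp_remainder:
  assumes "\<bar>x\<bar> \<le> R"
  shows "\<bar>x ^ i * exp (d * x) - (\<Sum>n<M. monomial_exp_coeff i d n * x ^ n)\<bar>
           \<le> (1 / 2) ^ M * ((2 * R) ^ i * exp (\<bar>d\<bar> * (2 * R)))"
proof -
  define t where "t = (\<lambda>n. monomial_exp_coeff i d n * x ^ n)"
  define s where "s = (\<lambda>n. monomial_exp_coeff i \<bar>d\<bar> n * (2 * R) ^ n)"
  have s: "s sums ((2 * R) ^ i * exp (\<bar>d\<bar> * (2 * R)))" "s n \<ge> 0" for n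
    using monomial_exp_sums[of i "\<bar>d\<bar>" "2 * R"] assms by (auto simp: s_def monomial_exp_coeff_def)
  have t: "t sums (x ^ i * exp (d * x))"
    unfolding t_def by (rule monomial_exp_sums)
  have le: "\<bar>t (n + M)\<bar> \<le> (1 / 2) ^ M * s (n + M)" for n
  proof -
    have "\<bar>t (n + M)\<bar> = monomial_exp_coeff i \<bar>d\<bar> (n + M) * \<bar>x\<bar> ^ (n + M)"
      by (simp add: t_def abs_mult abs_monomial_exp_coeff power_abs)
    also have "\<dots> \<le> monomial_exp_coeff i \<bar>d\<bar> (n + M) * R ^ (n + M)"
      using assms by (intro mult_left_mono power_mono) (auto simp: monomial_exp_coeff_def)
    also have "\<dots> = (1 / 2) ^ (n + M) * s (n + M)"
      by (simp add: s_def power_mult_distrib power_one_over)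
    also have "\<dots> \<le> (1 / 2) ^ M * s (n + M)"
      by (intro mult_right_mono power_decreasing s) auto
    finally show ?thesis .
  qed
  have sumS: "summable (\<lambda>n. s (n + M))"
    using s(1) by (subst summable_iff_shift) (auto simp: sums_iff)
  have sumT: "summable (\<lambda>n. \<bar>t (n + M)\<bar>)"
    by (rule summable_comparison_test'[OF summable_mult[OF sumS]]) (use le in auto)
  have "x ^ i * exp (d * x) - (\<Sum>n<M. t n) = (\<Sum>n. t (n + M))"
    using suminf_split_initial_segment[OF sums_summable[OF t], of M] sums_unique[OF t] by simp
  also have "\<bar>\<dots>\<bar> \<le> (\<Sum>n. \<bar>t (n + M)\<bar>)"
    by (rule summable_rabs[OF sumT])
  also have "\<dots> \<le> (\<Sum>n. (1 / 2) ^ M * s (n + M))"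
    by (intro suminf_le le sumT summable_mult sumS)
  also have "\<dots> = (1 / 2) ^ M * (\<Sum>n. s (n + M))"
    by (intro suminf_mult sumS)
  also have "(\<Sum>n. s (n + M)) \<le> suminf s"
    using suminf_split_initial_segment[OF sums_summable[OF s(1)], of M] s(2)
    by (simp add: sum_nonneg)
  finally show ?thesis using sums_unique[OF s(1)] by (simp add: t_def)
qed

text \<open>The pigeonhole principle makes the first \<open>M\<close> Taylor coefficients, scaled by
  \<open>R ^ n\<close>, at most \<epsilon>; they contribute \<open>M * \<epsilon>\<close>. The
  remainder of each of the \<open>T\<^sub>0 * T\<^sub>1\<close> monomials contributes at most
  \<open>H * ((1 / 2) ^ M * B)\<close>, where \<open>B\<close> bounds all majorants at radius
  \<open>2 * R\<close>.\<close>

lemma auxiliary_function: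
  fixes c R B \<epsilon> :: real and T\<^sub>0 T\<^sub>1 M H :: nat
  defines "I \<equiv> {..<T\<^sub>0} \<times> {..<T\<^sub>1}"
  defines "B \<equiv> (2 * R) ^ T\<^sub>0 * exp (2 * \<bar>c\<bar> * T\<^sub>1 * R)"
  assumes R: "R \<ge> 1" and \<epsilon>: "\<epsilon> > 0"
    and less: "(2 * (T\<^sub>0 * T\<^sub>1) * H * B / \<epsilon> + 2) ^ M < (real H + 1) ^ (T\<^sub>0 * T\<^sub>1)"
  shows "\<exists>p. (\<exists>i\<in>I. p i \<noteq> 0) \<and> (\<forall>i\<in>I. \<bar>p i\<bar> \<le> int H) \<and>
           (\<forall>x. \<bar>x\<bar> \<le> R \<longrightarrow> \<bar>\<Sum>(i, j)\<in>I. of_int (p (i, j)) * (x ^ i * exp (c * j * x))\<bar>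
                  \<le> M * \<epsilon> + T\<^sub>0 * T\<^sub>1 * H * ((1 / 2) ^ M * B))"
proof -
  define a where "a = (\<lambda>n (i, j). monomial_exp_coeff i (c * real j) n * R ^ n)"
  have B_ge: "(2 * R) ^ i * exp (\<bar>c * real j\<bar> * (2 * R)) \<le> B" if "(i, j) \<in> I" for i j
  proof -
    have "real j \<le> real T\<^sub>1" using that by (auto simp: I_def)
    then have "\<bar>c * real j\<bar> * (2 * R) \<le> 2 * \<bar>c\<bar> * T\<^sub>1 * R"
      using R by (simp add: abs_mult mult_left_mono mult_right_mono)
    then show ?thesis unfolding B_def using R that
      by (intro mult_mono power_increasing) (auto simp: I_def)
  qed
  have a_le: "\<bar>a n x\<bar> \<le> B" if x: "x \<in> I" for n x
  proof -
    obtain i j where ij: "x = (i, j)" by force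
    have "\<bar>a n x\<bar> \<le> R ^ i * exp (\<bar>c * real j\<bar> * R)"
      using monomial_exp_term_le[of R i "c * real j" n] R by (simp add: ij a_def abs_mult)
    also have "\<dots> \<le> (2 * R) ^ i * exp (\<bar>c * real j\<bar> * (2 * R))"
      using R by (intro mult_mono power_mono) (auto intro!: mult_left_mono)
    finally show ?thesis using B_ge x ij by fastforce
  qed
  have "card I = T\<^sub>0 * T\<^sub>1" "finite I" by (simp_all add: I_def)
  then obtain p :: "nat \<times> nat \<Rightarrow> int" where p: "\<exists>i\<in>I. p i \<noteq> 0" "\<forall>i\<in>I. \<bar>p i\<bar> \<le> int H"
      "\<forall>n\<in>{..<M}. \<bar>\<Sum>i\<in>I. of_int (p i) * a n i\<bar> \<le> \<epsilon>"
    using dirichlet_pigeonhole[of I "{..<M}" \<epsilon> a B H] \<epsilon> a_le less by auto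
  have "\<bar>\<Sum>(i, j)\<in>I. of_int (p (i, j)) * (x ^ i * exp (c * j * x))\<bar>
          \<le> M * \<epsilon> + T\<^sub>0 * T\<^sub>1 * H * ((1 / 2) ^ M * B)" if x: "\<bar>x\<bar> \<le> R" for x
  proof -
    define r where "r = (\<lambda>(i, j). x ^ i * exp (c * real j * x)
        - (\<Sum>n<M. monomial_exp_coeff i (c * real j) n * x ^ n))"
    have r: "\<bar>r y\<bar> \<le> (1 / 2) ^ M * B" if y: "y \<in> I" for y
    proof -
      obtain i j where ij: "y = (i, j)" by force
      have "\<bar>r y\<bar> \<le> (1 / 2) ^ M * ((2 * R) ^ i * exp (\<bar>c * real j\<bar> * (2 * R)))"
        unfolding r_def ij using monomial_exp_remainder[OF x] by simp
      also have "\<dots> \<le> (1 / 2) ^ M * B"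
        using B_ge[of i j] y ij by (intro mult_left_mono) auto
      finally show ?thesis .
    qed
    have "(\<Sum>(i, j)\<in>I. of_int (p (i, j)) * (x ^ i * exp (c * j * x)))
        = (\<Sum>(i, j)\<in>I. of_int (p (i, j)) * (\<Sum>n<M. monomial_exp_coeff i (c * real j) n * x ^ n))
          + (\<Sum>y\<in>I. of_int (p y) * r y)"
      by (simp add: r_def case_prod_unfold algebra_simps flip: sum.distrib)
    also have "(\<Sum>(i, j)\<in>I. of_int (p (i, j)) * (\<Sum>n<M. monomial_exp_coeff i (c * real j) n * x ^ n))
        = (\<Sum>n<M. (x / R) ^ n * (\<Sum>y\<in>I. of_int (p y) * a n y))"
      using R by (simp add: sum_distrib_left a_def case_prod_unfold power_divide sum.swap[of _ I] mult_ac)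
    finally have split: "(\<Sum>(i, j)\<in>I. of_int (p (i, j)) * (x ^ i * exp (c * j * x)))
        = (\<Sum>n<M. (x / R) ^ n * (\<Sum>y\<in>I. of_int (p y) * a n y)) + (\<Sum>y\<in>I. of_int (p y) * r y)" .
    have "\<bar>\<Sum>n<M. (x / R) ^ n * (\<Sum>y\<in>I. of_int (p y) * a n y)\<bar> \<le> (\<Sum>n<M. 1 * \<epsilon>)"
    proof (rule order.trans[OF sum_abs sum_mono])
      fix n assume "n \<in> {..<M}"
      moreover have "\<bar>(x / R) ^ n\<bar> \<le> 1" unfolding power_abs using x R by (intro power_le_one) auto
      ultimately show "\<bar>(x / R) ^ n * (\<Sum>y\<in>I. of_int (p y) * a n y)\<bar> \<le> 1 * \<epsilon>"
        unfolding abs_mult using p(3) by (intro mult_mono) auto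
    qed
    moreover have "\<bar>\<Sum>y\<in>I. of_int (p y) * r y\<bar> \<le> (\<Sum>y\<in>I. H * ((1 / 2) ^ M * B))"
    proof (rule order.trans[OF sum_abs sum_mono])
      fix y assume y: "y \<in> I"
      then have "\<bar>real_of_int (p y)\<bar> \<le> real H" using p(2) by (metis of_int_abs of_int_le_iff of_int_of_nat_eq)
      then show "\<bar>of_int (p y) * r y\<bar> \<le> H * ((1 / 2) ^ M * B)"
        unfolding abs_mult using r[OF y] by (intro mult_mono) auto
    qed
    ultimately show ?thesis unfolding split using \<open>card I = T\<^sub>0 * T\<^sub>1\<close>
      by (simp add: mult_ac) 
  qed
  with p show ?thesis by blast
qed

text \<open>At z = s + t x, the exponential with exponent \<open>ln a * j * z\<close> splits as
  \<open>a ^ (j * s) * (a powr x) ^ (j * t)\<close>, and \<open>a powr x\<close> is the value of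
  \<open>g\<close>. The factor \<open>q ^ (T\<^sub>1 * S)\<close> clears every denominator
  \<open>q ^ (j * s)\<close>.\<close>

lemma auxiliary_value_int_poly:
  fixes a x :: real and u q T\<^sub>0 T\<^sub>1 S s t H :: nat and p :: "nat \<times> nat \<Rightarrow> int"
  defines "I \<equiv> {..<T\<^sub>0} \<times> {..<T\<^sub>1}"
  assumes a: "a = real u / real q" "u > 0" "q > 0" and g: "a powr x = int_poly_eval g x"
    and st: "s < S" "t < S" and p: "\<And>i. i \<in> I \<Longrightarrow> \<bar>p i\<bar> \<le> int H"
  shows "\<exists>P. int_poly_eval P x = real q ^ (T\<^sub>1 * S) *
               (\<Sum>(i, j)\<in>I. of_int (p (i, j)) * ((s + t * x) ^ i * exp (ln a * j * (s + t * x))))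
           \<and> degree P \<le> T\<^sub>0 + T\<^sub>1 * S * degree g
           \<and> l1_norm P \<le> int (T\<^sub>0 * T\<^sub>1 * H * (2 * S) ^ T\<^sub>0) * (int u * int q * l1_norm g) ^ (T\<^sub>1 * S)"
proof -
  define L where "L = [:int s, int t:]"
  define w where "w = (\<lambda>(i, j). p (i, j) * int (u ^ (j * s) * q ^ (T\<^sub>1 * S - j * s)))"
  define b where "b = (\<lambda>(i, j). smult (w (i, j)) (L ^ i * g ^ (j * t)))"
  define P where "P = (\<Sum>y\<in>I. b y)"
  have a0: "a > 0" using a by simp
  have "int_poly_eval g x > 0" using g a0 by (metis powr_gt_zero less_irrefl)
  then have "g \<noteq> 0" by auto
  then have g1: "l1_norm g \<ge> 1" by (rule l1_norm_ge_1)
  have js: "j * s \<le> T\<^sub>1 * S" "j * t \<le> T\<^sub>1 * S" if "j < T\<^sub>1" for j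
    using that st by (auto intro!: mult_mono)
  have val: "int_poly_eval (b (i, j)) x = real q ^ (T\<^sub>1 * S) *
      (of_int (p (i, j)) * ((s + t * x) ^ i * exp (ln a * j * (s + t * x))))" if "j < T\<^sub>1" for i j
  proof -
    have "exp (ln a * j * (s + t * x)) = exp (real (j * s) * ln a) * exp (real (j * t) * (x * ln a))"
      by (simp add: exp_add[symmetric] algebra_simps)
    also have "\<dots> = a ^ (j * s) * (a powr x) ^ (j * t)"
      using a0 by (simp only: exp_of_nat_mult) (simp add: powr_def)
    also have "a ^ (j * s) = real u ^ (j * s) / real q ^ (j * s)"
      by (simp add: a(1) power_divide)
    finally have "real q ^ (T\<^sub>1 * S) * exp (ln a * j * (s + t * x))
        = real u ^ (j * s) * real q ^ (T\<^sub>1 * S - j * s) * int_poly_eval g x ^ (j * t)"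
      using js(1)[OF that] a(3) by (simp add: g power_diff)
    then show ?thesis by (simp add: b_def w_def L_def mult_ac)
  qed
  have "int_poly_eval P x = real q ^ (T\<^sub>1 * S) *
               (\<Sum>(i, j)\<in>I. of_int (p (i, j)) * ((s + t * x) ^ i * exp (ln a * j * (s + t * x))))"
    unfolding P_def int_poly_eval_sum sum_distrib_left
    by (intro sum.cong) (auto simp: I_def val)
  moreover have "degree P \<le> T\<^sub>0 + T\<^sub>1 * S * degree g"
    unfolding P_def
  proof (intro degree_sum_le)
    fix y assume "y \<in> I"
    then obtain i j where ij: "y = (i, j)" "i < T\<^sub>0" "j < T\<^sub>1" by (auto simp: I_def)
    have "degree (b y) \<le> degree (L ^ i) + degree (g ^ (j * t))"
      unfolding b_def ij(1) prod.case by (intro order.trans[OF degree_smult_le degree_mult_le])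
    also have "\<dots> \<le> degree L * i + degree g * (j * t)"
      by (intro add_mono degree_power_le)
    also have "degree L \<le> 1" by (simp add: L_def)
    also have "degree g * (j * t) \<le> degree g * (T\<^sub>1 * S)" using js(2)[OF ij(3)] by (rule mult_left_mono) simp
    finally show "degree (b y) \<le> T\<^sub>0 + T\<^sub>1 * S * degree g" using ij(2) by (simp add: mult_ac)
  qed (simp add: I_def)
  moreover have "l1_norm P \<le> int (T\<^sub>0 * T\<^sub>1 * H * (2 * S) ^ T\<^sub>0) * (int u * int q * l1_norm g) ^ (T\<^sub>1 * S)"
  proof -
    have "l1_norm (b y) \<le> (int H * (int u * int q) ^ (T\<^sub>1 * S)) * (int (2 * S) ^ T\<^sub>0 * l1_norm g ^ (T\<^sub>1 * S))"
      if y: "y \<in> I" for y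
    proof -
      obtain i j where ij: "y = (i, j)" "i < T\<^sub>0" "j < T\<^sub>1" using y by (auto simp: I_def)
      have "\<bar>w y\<bar> \<le> int H * (int u * int q) ^ (T\<^sub>1 * S)"
      proof -
        have "u ^ (j * s) * q ^ (T\<^sub>1 * S - j * s) \<le> u ^ (T\<^sub>1 * S) * q ^ (T\<^sub>1 * S)"
          using js(1)[OF ij(3)] a by (intro mult_le_mono[OF power_increasing power_increasing]) auto
        then have "int (u ^ (j * s) * q ^ (T\<^sub>1 * S - j * s)) \<le> (int u * int q) ^ (T\<^sub>1 * S)"
          by (metis of_nat_mono of_nat_mult of_nat_power power_mult_distrib)
        then show ?thesis unfolding w_def ij(1) prod.case abs_mult
          using p[OF y] ij(1) by (intro mult_mono) auto
      qed
      moreover have "l1_norm (L ^ i * g ^ (j * t)) \<le> int (2 * S) ^ T\<^sub>0 * l1_norm g ^ (T\<^sub>1 * S)"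
      proof -
        have "l1_norm L \<le> int (2 * S)" using st by (simp add: L_def)
        then have "l1_norm (L ^ i) \<le> int (2 * S) ^ i"
          by (intro order.trans[OF l1_norm_power] power_mono) auto
        also have "\<dots> \<le> int (2 * S) ^ T\<^sub>0" using ij(2) st by (intro power_increasing) auto
        finally have "l1_norm (L ^ i) \<le> int (2 * S) ^ T\<^sub>0" .
        moreover have "l1_norm (g ^ (j * t)) \<le> l1_norm g ^ (T\<^sub>1 * S)"
          using js(2)[OF ij(3)] g1 by (intro order.trans[OF l1_norm_power] power_increasing) auto
        ultimately show ?thesis
          by (intro order.trans[OF l1_norm_mult] mult_mono) auto
      qed
      ultimately show ?thesis unfolding b_def ij(1) prod.case l1_norm_smult
        by (intro mult_mono) auto
    qed
    then have "l1_norm P \<le> (\<Sum>y\<in>I. (int H * (int u * int q) ^ (T\<^sub>1 * S)) * (int (2 * S) ^ T\<^sub>0 * l1_norm g ^ (T\<^sub>1 * S)))"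
      unfolding P_def by (intro order.trans[OF l1_norm_sum] sum_mono) auto
    then show ?thesis by (simp add: I_def power_mult_distrib mult_ac)
  qed
  ultimately show ?thesis by blast
qed

text \<open>The assumption on \<open>g\<close> keeps all values in Z[x]. In the application
  \<open>a\<close> is \<open>A ^ k\<close>, \<open>x\<close> is \<open>h A\<close>, and the fixed
  point equation gives \<open>a powr x = x ^ k\<close>, so that \<open>g\<close> is a
  monomial.\<close>

lemma gelfond_schneider_rational_base:
  fixes a x :: real
  assumes a: "a \<in> \<rat>" "a > 0" "a \<noteq> 1" and x: "algebraic x" and g: "a powr x = int_poly_eval g x"
  shows "x \<in> \<rat>"
proof (rule ccontr)
  assume irrational: "x \<notin> \<rat>"
  obtain u q :: nat where uq: "a = real u / real q" "u > 0" "q > 0"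
  proof -
    obtain m n :: nat where "n \<noteq> 0" "\<bar>a\<bar> = real m / real n"
      using Rats_abs_nat_div_natE[OF a(1)] by metis
    then show ?thesis using that[of m n] a(2) by (cases "m = 0") auto
  qed
  obtain C K where C: "C \<ge> 1" and liouville: "\<And>p. int_poly_eval p x \<noteq> 0 \<Longrightarrow>
      1 \<le> \<bar>int_poly_eval p x\<bar> * C ^ Suc (degree p) * of_int (l1_norm p) ^ K"
    using liouville_polynomial_bound[OF x] by blast
  have "g \<noteq> 0" using g a(2) by (metis powr_gt_zero less_irrefl int_poly_eval_0)
  define c where "c = ln a"
  have c: "c \<noteq> 0" using a by (simp add: c_def)
  define b where "b = 1 + \<bar>x\<bar>"
  define \<gamma> where "\<gamma> = real_of_int (l1_norm g)"
  \<comment> \<open>Liouville's inequality will cost \<open>Z ^ (2 * K + 2)\<close>; the remaining 5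
    has to beat the \<open>Z ^ 4\<close> of \<open>F_small\<close>.\<close>
  define \<kappa> where "\<kappa> = 2 * K + 7"
  \<comment> \<open>\<open>X\<close> dominates the three bases that occur with exponent
    \<open>N ^ 6\<close>: one from the Taylor majorant, one from the norm of the polynomial values,
    one from their degree in Liouville's inequality.\<close>
  define X where "X = (2 * b * exp (2 * \<bar>c\<bar> * b)) * (2 * (u * q * \<gamma>)) * C ^ (degree g + 2)"
  have \<gamma>: "\<gamma> \<ge> 1" using l1_norm_ge_1[OF \<open>g \<noteq> 0\<close>] by (simp add: \<gamma>_def)
  have uq1: "real u \<ge> 1" "real q \<ge> 1" using uq by auto
  have b: "b \<ge> 1" by (simp add: b_def)
  define X1 where "X1 = 2 * b * exp (2 * \<bar>c\<bar> * b)"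
  define X2 where "X2 = 2 * (u * q * \<gamma>)"
  define X3 where "X3 = C ^ (degree g + 2)"
  have X1: "X1 \<ge> 1" unfolding X1_def using b by (intro mult_ge1_I) auto
  have X2: "X2 \<ge> 1" "X2 \<ge> q"
  proof -
    have "1 * (1 * 1) * real q \<le> 2 * (real u * \<gamma>) * real q"
      using uq1 \<gamma> by (intro mult_right_mono[of "1 * (1 * 1)"] mult_mono) auto
    then show "X2 \<ge> q" by (simp add: X2_def mult_ac)
    then show "X2 \<ge> 1" using uq1 by linarith
  qed
  have X3: "X3 \<ge> 1" unfolding X3_def using C by (intro one_le_power)
  have X_ge: "X1 \<le> X" "X2 \<le> X" "X3 \<le> X" "X \<ge> 1"
  proof -
    have X: "X = X1 * X2 * X3" by (simp add: X_def X1_def X2_def X3_def)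
    have *: "y \<le> y * z" if "y \<ge> 1" "z \<ge> 1" for y z :: real
      using that by (simp add: mult_le_cancel_left1)
    have **: "1 \<le> y * z" if "y \<ge> 1" "z \<ge> 1" for y z :: real
      using that *[of y z] by linarith
    show "X1 \<le> X" using *[of X1 "X2 * X3"] **[of X2 X3] X1 X2 X3 by (simp add: X mult_ac)
    show "X2 \<le> X" using *[of X2 "X1 * X3"] **[of X1 X3] X1 X2 X3 by (simp add: X mult_ac)
    show "X3 \<le> X" using *[of X3 "X1 * X2"] **[of X1 X2] X1 X2 X3 by (simp add: X mult_ac)
    then show "X \<ge> 1" using X3 by linarith
  qed
  have "(\<lambda>N::nat. real N ^ 12 / 2 ^ N) \<longlonglongrightarrow> 0" by real_asymp
  then have "eventually (\<lambda>N::nat. real N ^ 12 / 2 ^ N < 1 / X) sequentially"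
    using X_ge(4) by (intro order_tendstoD(2)) auto
  \<comment> \<open>The second condition is what the pigeonhole principle needs,
    \<open>(\<kappa> + 5) * M \<le> N ^ 8\<close>.\<close>
  then have "eventually (\<lambda>N::nat. real N ^ 12 / 2 ^ N < 1 / X \<and> N \<ge> \<kappa> * (\<kappa> + 5)) sequentially"
    using eventually_ge_at_top by (rule eventually_conj)
  then obtain N :: nat where N': "real N ^ 12 / 2 ^ N < 1 / X" "N \<ge> \<kappa> * (\<kappa> + 5)"
    using eventually_happens'[OF sequentially_bot] by blast
  then have N: "X * real N ^ 12 \<le> 2 ^ N" "N \<ge> \<kappa> * (\<kappa> + 5)"
    using X_ge(4) by (simp_all add: field_simps)
  have "\<kappa> \<ge> 7" by (simp add: \<kappa>_def)
  then have N\<kappa>: "N \<ge> \<kappa>" "N \<ge> 1" using N(2) by (simp_all add: algebra_simps)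
  define Z where "Z = (2::real) ^ (N ^ 7)"
  have absorb: "y ^ (N ^ 6) \<le> Z" if "0 \<le> y" "y \<le> X * real N ^ 12" for y
  proof -
    have "y ^ (N ^ 6) \<le> (2 ^ N) ^ (N ^ 6)" using that N by (intro power_mono) auto
    also have "\<dots> = Z" by (simp add: Z_def power_mult[symmetric] flip: power_Suc)
    finally show ?thesis .
  qed
  have Nk: "real N ^ k \<le> real N ^ 12" if "k \<le> 12" for k
    using that N\<kappa> by (intro power_increasing) auto
  have N12: "real N ^ 12 \<ge> 1" using N\<kappa> by simp
  have Z2: "Z \<ge> 2"
    using power_increasing[of 1 "N ^ 7" "2::real"] N\<kappa> by (simp add: Z_def)
  \<comment> \<open>There are \<open>N ^ 8\<close> coefficients against \<open>\<kappa> * N ^ 7\<close> conditions on Taylor coefficients;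
    every factor of lower order, such as \<open>y ^ (N ^ 6)\<close> with \<open>y\<close> polynomial in \<open>N\<close>, is absorbed
    into one power of \<open>Z = 2 ^ (N ^ 7)\<close>, and \<open>\<kappa>\<close> exceeds the number of powers of \<open>Z\<close> lost to Liouville.\<close>
  define T\<^sub>0 where "T\<^sub>0 = N ^ 6"
  define T\<^sub>1 where "T\<^sub>1 = N ^ 2"
  define S where "S = N ^ 4"
  define H where "H = (2::nat) ^ (N ^ 7)"
  define M where "M = \<kappa> * N ^ 7"
  define R where "R = S * b"
  define B where "B = (2 * R) ^ T\<^sub>0 * exp (2 * \<bar>c\<bar> * T\<^sub>1 * R)"
  have T01: "T\<^sub>0 * T\<^sub>1 = N ^ 8" and T1S: "T\<^sub>1 * S = N ^ 6"
    by (simp_all add: T\<^sub>0_def T\<^sub>1_def S_def flip: power_add)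
  have HZ: "real H = Z" by (simp add: H_def Z_def)
  have MZ: "(2::real) ^ M = Z ^ \<kappa>" by (simp add: M_def Z_def mult.commute flip: power_mult)
  have S1: "real S \<ge> 1" using N\<kappa> by (simp add: S_def)
  have R: "R \<ge> 1" using mult_mono[OF S1 b] by (simp add: R_def)
  have B: "B \<le> Z" "B \<ge> 0"
  proof -
    have "B = (X1 * real N ^ 4) ^ (N ^ 6)"
    proof -
      have "exp (2 * \<bar>c\<bar> * T\<^sub>1 * R) = exp (real (N ^ 6) * (2 * \<bar>c\<bar> * b))"
        unfolding R_def T1S[symmetric] by (simp add: mult_ac)
      also have "\<dots> = exp (2 * \<bar>c\<bar> * b) ^ (N ^ 6)" by (rule exp_of_nat_mult)
      finally show ?thesis
        by (simp add: B_def T\<^sub>0_def R_def S_def X1_def power_mult_distrib mult_ac)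
    qed
    also have "\<dots> \<le> Z"
      using X1 X_ge Nk[of 4] by (intro absorb mult_mono) auto
    finally show "B \<le> Z" .
    show "B \<ge> 0" using R by (simp add: B_def)
  qed
  have N8: "real N ^ 8 \<le> Z"
  proof -
    have "real N ^ 8 \<le> real N ^ 12" by (intro Nk) simp
    also have "\<dots> \<le> (real N ^ 12) ^ (N ^ 6)"
      using N12 N\<kappa> power_increasing[of 1 "N ^ 6" "real N ^ 12"] by simp
    also have "\<dots> \<le> Z"
      using X_ge N12 mult_right_mono[of 1 X "real N ^ 12"] by (intro absorb) auto
    finally show ?thesis .
  qed
  have qZ: "real q ^ (T\<^sub>1 * S) \<le> Z"
  proof -
    have "1 * real q \<le> real N ^ 12 * X"
      using N12 X_ge X2 uq1 by (intro mult_mono) auto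
    then show ?thesis unfolding T1S by (intro absorb) (auto simp: mult.commute)
  qed
  \<comment> \<open>\<open>N ^ 8\<close>, \<open>H\<close> and \<open>B\<close> cost one
    \<open>Z\<close> each and the constants two more, so each of the \<open>M\<close> conditions
    takes at most \<open>Z ^ (\<kappa> + 5)\<close> cells.\<close>
  have "(2 * (T\<^sub>0 * T\<^sub>1) * H * B / (1 / Z ^ \<kappa>) + 2) ^ M < (real H + 1) ^ (T\<^sub>0 * T\<^sub>1)"
  proof -
    have "real (T\<^sub>0 * T\<^sub>1) * H * B \<le> Z * Z * Z"
      unfolding T01 HZ using N8 B Z2 by (intro mult_mono) auto
    then have "2 * (T\<^sub>0 * T\<^sub>1) * H * B / (1 / Z ^ \<kappa>) + 2 \<le> 2 * (Z * Z * Z) * Z ^ \<kappa> + 2"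
      using Z2 by (simp add: mult_right_mono mult.assoc)
    also have "\<dots> \<le> 2 * (Z * Z * Z) * Z ^ \<kappa> + 2 * (Z * Z * Z) * Z ^ \<kappa>"
    proof -
      have "1 \<le> (Z * Z * Z) * Z ^ \<kappa>" using Z2 by (intro mult_ge1_I one_le_power) auto
      then show ?thesis by linarith
    qed
    also have "\<dots> = (2 * 2) * (Z * Z * Z * Z ^ \<kappa>)" by simp
    also have "\<dots> \<le> (Z * Z) * (Z * Z * Z * Z ^ \<kappa>)"
      using Z2 by (intro mult_right_mono mult_mono) auto
    also have "\<dots> = Z ^ (\<kappa> + 5)" by (simp add: power_add eval_nat_numeral mult_ac)
    finally have "(2 * (T\<^sub>0 * T\<^sub>1) * H * B / (1 / Z ^ \<kappa>) + 2) ^ M \<le> (Z ^ (\<kappa> + 5)) ^ M"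
      using B Z2 by (intro power_mono) (auto intro!: add_nonneg_nonneg)
    also have "\<dots> = Z ^ ((\<kappa> + 5) * M)" by (simp add: power_mult)
    also have "\<dots> \<le> Z ^ (N ^ 8)"
    proof (rule power_increasing)
      have "(\<kappa> + 5) * M \<le> N * N ^ 7" using N(2) by (simp add: M_def mult.commute)
      then show "(\<kappa> + 5) * M \<le> N ^ 8" by (simp flip: power_Suc)
    qed (use Z2 in simp)
    also have "\<dots> < (real H + 1) ^ (T\<^sub>0 * T\<^sub>1)"
      unfolding T01 HZ using Z2 N\<kappa> by (intro power_strict_mono) auto
    finally show ?thesis .
  qed
  then obtain p where p0: "\<exists>i\<in>{..<T\<^sub>0} \<times> {..<T\<^sub>1}. p i \<noteq> 0"
    and pH: "\<And>i. i \<in> {..<T\<^sub>0} \<times> {..<T\<^sub>1} \<Longrightarrow> \<bar>p i\<bar> \<le> int H"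
    and small: "\<And>z. \<bar>z\<bar> \<le> R \<Longrightarrow>
      \<bar>\<Sum>(i, j)\<in>{..<T\<^sub>0} \<times> {..<T\<^sub>1}. of_int (p (i, j)) * (z ^ i * exp (c * j * z))\<bar>
        \<le> M * (1 / Z ^ \<kappa>) + T\<^sub>0 * T\<^sub>1 * H * ((1 / 2) ^ M * B)"
    using auxiliary_function[of R "1 / Z ^ \<kappa>" T\<^sub>0 T\<^sub>1 H c M] R Z2 unfolding B_def by auto
  define F where "F = (\<lambda>z. \<Sum>(i, j)\<in>{..<T\<^sub>0} \<times> {..<T\<^sub>1}. of_int (p (i, j)) * (z ^ i * exp (c * j * z)))"
  have F_small: "\<bar>F z\<bar> * Z ^ \<kappa> \<le> Z ^ 4" if "\<bar>z\<bar> \<le> R" for z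
  proof -
    have "real M \<le> Z"
    proof -
      have "M \<le> N * N ^ 7" using N\<kappa> by (simp add: M_def)
      also have "N * N ^ 7 = N ^ 8" by (simp flip: power_Suc)
      finally show ?thesis using N8 by (metis of_nat_le_iff of_nat_power order.trans)
    qed
    moreover have "real (T\<^sub>0 * T\<^sub>1) * H * B \<le> Z * Z * Z"
      unfolding T01 HZ using N8 B Z2 by (intro mult_mono) auto
    moreover have "\<bar>F z\<bar> * Z ^ \<kappa> \<le> (M * (1 / Z ^ \<kappa>) + T\<^sub>0 * T\<^sub>1 * H * ((1 / 2) ^ M * B)) * Z ^ \<kappa>"
      using small[OF that] Z2 unfolding F_def by (intro mult_right_mono) auto
    moreover have "\<dots> = M + T\<^sub>0 * T\<^sub>1 * H * B"
      using Z2 MZ by (simp add: power_one_over field_simps)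
    ultimately have "\<bar>F z\<bar> * Z ^ \<kappa> \<le> Z + Z * Z * Z" by simp
    also have "\<dots> \<le> Z * Z * Z + Z * Z * Z"
      using Z2 mult_mono[of 1 "Z * Z" Z Z] mult_mono[of 1 Z 1 Z] by simp
    also have "\<dots> = 2 * (Z * Z * Z)" by simp
    also have "\<dots> \<le> Z * (Z * Z * Z)" using Z2 by (intro mult_right_mono) auto
    finally show ?thesis by (simp add: eval_nat_numeral mult_ac)
  qed
  define \<zeta> where "\<zeta> = (\<lambda>(s, t). real s + real t * x)"
  have \<zeta>_zero: "F (\<zeta> (s, t)) = 0" if st: "s < S" "t < S" for s t
  proof (rule ccontr)
    assume nz: "F (\<zeta> (s, t)) \<noteq> 0"
    obtain P where P: "int_poly_eval P x = real q ^ (T\<^sub>1 * S) * F (\<zeta> (s, t))"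
      "degree P \<le> T\<^sub>0 + T\<^sub>1 * S * degree g"
      "l1_norm P \<le> int (T\<^sub>0 * T\<^sub>1 * H * (2 * S) ^ T\<^sub>0) * (int u * int q * l1_norm g) ^ (T\<^sub>1 * S)"
      using auxiliary_value_int_poly[OF uq g st, where T\<^sub>0 = T\<^sub>0 and T\<^sub>1 = T\<^sub>1 and p = p and H = H, OF pH]
      unfolding F_def \<zeta>_def c_def prod.case by - (drule meta_mp, assumption, elim exE conjE, simp)
    have "int_poly_eval P x \<noteq> 0" using P(1) nz uq by simp
    then have "1 \<le> \<bar>int_poly_eval P x\<bar> * C ^ Suc (degree P) * of_int (l1_norm P) ^ K"
      by (rule liouville)
    also have "\<dots> \<le> (Z * \<bar>F (\<zeta> (s, t))\<bar>) * Z * (Z ^ 2) ^ K"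
    proof (intro mult_mono power_mono)
      show "\<bar>int_poly_eval P x\<bar> \<le> Z * \<bar>F (\<zeta> (s, t))\<bar>"
        unfolding P(1) abs_mult using qZ by (intro mult_right_mono) auto
      have "Suc (degree P) \<le> (degree g + 2) * N ^ 6"
        using P(2) one_le_power[OF N\<kappa>(2), of 6] unfolding T1S T\<^sub>0_def by (simp add: algebra_simps)
      then have "C ^ Suc (degree P) \<le> C ^ ((degree g + 2) * N ^ 6)"
        using C by (intro power_increasing)
      also have "\<dots> = X3 ^ (N ^ 6)" by (simp only: X3_def power_mult)
      also have "\<dots> \<le> Z"
        using X3 X_ge N12 mult_mono[of X3 X 1 "real N ^ 12"] by (intro absorb) auto
      finally show "C ^ Suc (degree P) \<le> Z" .
      have "real_of_int (l1_norm P) \<le> real N ^ 8 * Z * (2 * real N ^ 4) ^ (N ^ 6) * (u * q * \<gamma>) ^ (N ^ 6)"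
        using of_int_le_iff[where 'a = real, THEN iffD2, OF P(3)]
        unfolding T01 T1S unfolding T\<^sub>0_def S_def by (simp add: HZ \<gamma>_def mult_ac)
      also have "\<dots> = Z * (real N ^ 8 * (real N ^ 4 * X2) ^ (N ^ 6))"
        by (simp add: X2_def power_mult_distrib mult_ac)
      also have "real N ^ 8 * (real N ^ 4 * X2) ^ (N ^ 6)
          \<le> (real N ^ 8) ^ (N ^ 6) * (real N ^ 4 * X2) ^ (N ^ 6)"
        using N\<kappa> X2 power_increasing[of 1 "N ^ 6" "real N ^ 8"] by (intro mult_right_mono) auto
      also have "\<dots> = (X2 * real N ^ 12) ^ (N ^ 6)"
        by (simp add: power_mult_distrib mult_ac flip: power_add power_mult)
      also have "\<dots> \<le> Z" using X2 X_ge by (intro absorb mult_right_mono) auto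
      finally show "real_of_int (l1_norm P) \<le> Z ^ 2" using Z2 by (simp add: power2_eq_square)
    qed (use Z2 C in auto)
    also have "\<dots> = \<bar>F (\<zeta> (s, t))\<bar> * Z ^ (2 * K + 2)"
      by (simp add: power_add power_mult_distrib eval_nat_numeral mult_ac)
    finally have "Z ^ 5 \<le> \<bar>F (\<zeta> (s, t))\<bar> * Z ^ (2 * K + 2) * Z ^ 5"
      using Z2 by simp
    also have "\<dots> = \<bar>F (\<zeta> (s, t))\<bar> * Z ^ \<kappa>"
    proof -
      have "\<kappa> = (2 * K + 2) + 5" by (simp add: \<kappa>_def)
      then show ?thesis by (simp only: power_add mult.assoc)
    qed
    also have "\<dots> \<le> Z ^ 4"
    proof (rule F_small)
      have "real s \<le> real S" "real t * \<bar>x\<bar> \<le> real S * \<bar>x\<bar>"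
        using st by (auto intro!: mult_right_mono)
      then show "\<bar>\<zeta> (s, t)\<bar> \<le> R"
        unfolding \<zeta>_def R_def b_def by (simp add: abs_mult algebra_simps order.trans[OF abs_triangle_ineq])
    qed
    finally have "Z ^ 5 \<le> Z ^ 4" .
    moreover have "Z ^ 4 < Z ^ 5" using Z2 by (intro power_strict_increasing) auto
    ultimately show False by simp
  qed
  define G where "G = {..<S} \<times> {..<S}"
  \<comment> \<open>Here irrationality of \<open>x\<close> enters: it makes the points s + t x
    pairwise distinct.\<close>
  have inj: "inj_on \<zeta> G"
  proof (rule inj_onI, clarify)
    fix s t s' t' assume "\<zeta> (s, t) = \<zeta> (s', t')"
    then have eq: "real s - real s' = (real t' - real t) * x" by (simp add: \<zeta>_def algebra_simps)
    have "t = t'"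
    proof (rule ccontr)
      assume "t \<noteq> t'"
      then have "x = (real s - real s') / (real t' - real t)" using eq by (simp add: field_simps)
      then show False using irrational by simp
    qed
    with eq show "s = s' \<and> t = t'" by simp
  qed
  define Pj where "Pj = (\<lambda>j. \<Sum>i<T\<^sub>0. monom (real_of_int (p (i, j))) i)"
  have F_Pj: "F z = (\<Sum>j<T\<^sub>1. poly (Pj j) z * exp (c * real j * z))" for z
    unfolding F_def Pj_def
    unfolding sum.cartesian_product[symmetric] sum.swap[of _ "{..<T\<^sub>1}"]
      poly_sum poly_monom sum_distrib_right by (simp add: mult_ac)
  \<comment> \<open>There are \<open>S ^ 2\<close> zeros and at most
    \<open>T\<^sub>0 * T\<^sub>1\<close> coefficients, and both numbers are \<open>N ^ 8\<close>:
    the contradiction lies in the strictness of the zero estimate.\<close>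
  have "card (\<zeta> ` G) < (\<Sum>j<T\<^sub>1. length (coeffs (Pj j)))"
  proof (rule exponential_polynomial_zeros)
    show "inj_on (\<lambda>j. c * real j) {..<T\<^sub>1}" using c by (auto intro: inj_onI)
    show "finite (\<zeta> ` G)" by (simp add: G_def)
    obtain i j where ij: "i < T\<^sub>0" "j < T\<^sub>1" "p (i, j) \<noteq> 0" using p0 by auto
    have "coeff (Pj j) i = of_int (p (i, j))" using ij(1) by (simp add: Pj_def coeff_sum)
    then show "\<exists>j\<in>{..<T\<^sub>1}. Pj j \<noteq> 0" using ij by (intro bexI[of _ j]) auto
    show "(\<Sum>j<T\<^sub>1. poly (Pj j) z * exp (c * real j * z)) = 0" if "z \<in> \<zeta> ` G" for z
      using that \<zeta>_zero unfolding F_Pj[symmetric] G_def by auto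
  qed simp
  also have "\<dots> \<le> (\<Sum>j<T\<^sub>1. T\<^sub>0)"
  proof (rule sum_mono)
    fix j
    have "degree (Pj j) < T\<^sub>0"
      unfolding Pj_def using N\<kappa>
      by (intro degree_sum_less) (auto simp: T\<^sub>0_def intro: le_less_trans[OF degree_monom_le])
    then show "length (coeffs (Pj j)) \<le> T\<^sub>0" by (simp add: coeffs_def)
  qed
  also have "\<dots> = N ^ 8" using T01 by (simp add: mult.commute)
  also have "card (\<zeta> ` G) = N ^ 8"
    using card_image[OF inj] by (simp add: G_def S_def flip: power_add)
  finally show False by simp
qed

section \<open>Convergence of the power tower\<close>

lemma LIMSEQ_even_odd:
  fixes X :: "nat \<Rightarrow> 'a :: topological_space"
  assumes "(\<lambda>n. X (2 * n)) \<longlonglongrightarrow> L" "(\<lambda>n. X (2 * n + 1)) \<longlonglongrightarrow> L"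
  shows "X \<longlonglongrightarrow> L"
proof (rule topological_tendstoI)
  fix S assume S: "open S" "L \<in> S"
  obtain M where M: "\<And>n. n \<ge> M \<Longrightarrow> X (2 * n) \<in> S"
    using topological_tendstoD[OF assms(1) S] by (auto simp: eventually_sequentially)
  obtain N where N: "\<And>n. n \<ge> N \<Longrightarrow> X (2 * n + 1) \<in> S"
    using topological_tendstoD[OF assms(2) S] by (auto simp: eventually_sequentially)
  have "X n \<in> S" if n: "n \<ge> 2 * (M + N) + 1" for n
  proof (cases "even n")
    case True
    then obtain m where "n = 2 * m" by blast
    then show ?thesis using M n by simp
  next
    case False
    then obtain m where "n = 2 * m + 1" by (blast elim: oddE)
    then show ?thesis using N n by simp
  qed
  then show "\<forall>\<^sub>F n in sequentially. X n \<in> S"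
    by (auto simp: eventually_sequentially)
qed

lemma mult_exp_minus_le:
  fixes w :: real
  shows "w * exp (- w) \<le> exp (- 1)"
proof -
  have "w \<le> exp (w - 1)" using exp_ge_add_one_self[of "w - 1"] by simp
  then have "w * exp (- w) \<le> exp (w - 1) * exp (- w)" by (intro mult_right_mono) auto
  then show ?thesis by (simp flip: exp_add)
qed

lemma mult_exp_minus_eq_iff:
  fixes w :: real
  shows "w * exp (- w) = exp (- 1) \<longleftrightarrow> w = 1"
proof
  assume "w * exp (- w) = exp (- 1)"
  then have eq: "exp (w - 1) = w" by (simp add: exp_diff exp_minus field_simps)
  then have "w > 0" by (metis exp_gt_zero)
  moreover have "ln w = w - 1" using eq by (metis ln_exp)
  ultimately show "w = 1" by (rule ln_eq_minus_one)
qed simp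

text \<open>The derivative of the twice iterated map is \<open>- ln x * w * exp (- w)\<close> with
  \<open>w = - ln x * x powr y\<close>, hence at most \<open>1\<close> with equality for at most one \<open>y\<close>; this
  excludes 2-cycles.\<close>

lemma powr_powr_fixed_point_unique:
  fixes x p q :: real
  assumes x: "exp (- exp 1) \<le> x" "x < 1" and p: "x powr (x powr p) = p" and q: "x powr (x powr q) = q"
  shows "p = q"
proof -
  define c where "c = - ln x"
  have x0: "x > 0" using x(1) exp_gt_zero less_le_trans by blast
  have c: "0 < c" "c \<le> exp 1"
    using x x0 ln_mono[of "exp (- exp 1)" x] by (auto simp: c_def)
  define f where "f = (\<lambda>y. y - exp (- c * exp (- c * y)))"
  define f' where "f' = (\<lambda>y. 1 - c * ((c * exp (- c * y)) * exp (- (c * exp (- c * y)))))"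
  have f_eq: "f y = y - x powr (x powr y)" for y
    using x0 by (simp add: f_def powr_def c_def mult_ac)
  have deriv: "(f has_real_derivative f' y) (at y)" for y
    unfolding f_def f'_def by (auto intro!: derivative_eq_intros simp: algebra_simps)
  have le: "c * (w * exp (- w)) \<le> 1" for w
  proof -
    have "c * (w * exp (- w)) \<le> exp 1 * exp (- 1)"
      using c mult_exp_minus_le[of w]
      by (intro order.trans[OF mult_left_mono mult_right_mono]) auto
    then show ?thesis by (simp flip: exp_add)
  qed
  have nonneg: "f' y \<ge> 0" for y using le[of "c * exp (- c * y)"] by (simp add: f'_def)
  have mono: "f a \<le> f b" if "a \<le> b" for a b
    by (rule DERIV_nonneg_imp_nondecreasing[OF that]) (use deriv nonneg in blast)
  \<comment> \<open>As \<open>f\<close> is nondecreasing, two zeros would make it vanish on the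
    whole interval between them. Equality in \<open>le\<close> would then hold at two different
    points of that interval.\<close>
  have no_two: False if "a < b" "f a = 0" "f b = 0" for a b
  proof -
    have "f y = 0" if "y \<in> {a..b}" for y
      using mono[of a y] mono[of y b] that \<open>f a = 0\<close> \<open>f b = 0\<close> by auto
    then have zero: "f' y = 0" if "y \<in> {a<..<b}" for y
      using that DERIV_local_const[OF deriv[of y], of "min (y - a) (b - y)"]
      by (auto simp: abs_if split: if_splits)
    have "c * exp (- c * y) = 1" if y: "y \<in> {a<..<b}" for y
    proof -
      define w where "w = c * exp (- c * y)"
      have eq: "c * (w * exp (- w)) = 1" using zero[OF y] by (simp add: f'_def w_def)
      then have pos: "w * exp (- w) > 0" using c by (metis zero_less_mult_pos zero_less_one)
      have "c * (w * exp (- w)) \<le> exp 1 * (w * exp (- w))"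
        using c pos by (intro mult_right_mono) auto
      then have "exp (- 1) \<le> w * exp (- w)" unfolding eq by (simp add: exp_minus field_simps)
      then have "w * exp (- w) = exp (- 1)" using mult_exp_minus_le[of w] by simp
      then show ?thesis unfolding mult_exp_minus_eq_iff w_def .
    qed
    from this[of "(2 * a + b) / 3"] this[of "(a + 2 * b) / 3"] \<open>a < b\<close>
    have "c * exp (- c * ((2 * a + b) / 3)) = c * exp (- c * ((a + 2 * b) / 3))" by simp
    then show False using c \<open>a < b\<close> by simp
  qed
  have "f p = 0" "f q = 0" using p q by (simp_all add: f_eq)
  with no_two[of p q] no_two[of q p] have "\<not> p < q" "\<not> q < p" by auto
  then show ?thesis by simp
qed

text \<open>The sequence is monotone, and the bound e passes from each term to the next because
  \<open>exp (1 / exp 1) powr exp 1 = exp 1\<close>.\<close>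

lemma tower_converges_ge_1:
  assumes x: "1 \<le> x" "x \<le> exp (1 / exp 1)"
  shows "\<exists>L. tower x \<longlonglongrightarrow> L \<and> 1 \<le> L \<and> L \<le> exp 1"
proof -
  have upper: "tower x n \<le> exp 1" for n
  proof (induction n)
    case 0
    have "x \<le> exp (1 / exp 1)" by (rule x)
    also have "\<dots> \<le> exp (1 :: real)" by simp
    finally show ?case by simp
  next
    case (Suc n)
    have "x powr tower x n \<le> exp (1 / exp 1) powr exp 1"
      using x Suc by (intro order.trans[OF powr_mono powr_mono2]) auto
    then show ?case by (simp add: powr_def)
  qed
  have incr: "tower x n \<le> tower x (Suc n)" for n
  proof (induction n)
    case 0
    show ?case using x powr_mono[of 1 x x] by simp
  next
    case (Suc n)
    then show ?case using x powr_mono[of "tower x n" "tower x (Suc n)" x] by simp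
  qed
  have "incseq (tower x)" using incr by (rule incseq_SucI)
  then obtain L where L: "tower x \<longlonglongrightarrow> L"
    by (rule incseq_convergent[of "tower x" "exp 1"]) (use upper in auto)
  moreover have "L \<ge> tower x 0" using incseq_le[OF \<open>incseq (tower x)\<close> L] .
  moreover have "L \<le> exp 1" using LIMSEQ_le_const2[OF L] upper by blast
  ultimately show ?thesis using x by auto
qed

text \<open>The iterated map is decreasing, so the even terms increase and the odd terms decrease.
  Their limits p and q are exchanged by the map and hence both fixed by its second iterate, whose
  fixed point is unique.\<close>

lemma tower_converges_lt_1:
  assumes x: "exp (- exp 1) \<le> x" "x < 1"
  shows "\<exists>L. tower x \<longlonglongrightarrow> L \<and> 0 < L \<and> L \<le> 1"
proof -
  have x0: "x > 0" using x(1) exp_gt_zero less_le_trans by blast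
  have anti: "x powr b \<le> x powr a" if "a \<le> b" for a b
    using powr_mono'[OF that, of x] x x0 by simp
  have pos: "tower x n > 0" for n using x0 by (cases n) auto
  have le1: "tower x n \<le> 1" for n
  proof (cases n)
    case (Suc m)
    then show ?thesis using anti[OF less_imp_le[OF pos[of m]]] x0 by simp
  qed (use x in simp)
  have even_odd: "tower x (2 * n) \<le> tower x (2 * Suc n) \<and> tower x (2 * Suc n + 1) \<le> tower x (2 * n + 1)" for n
  proof (induction n)
    case 0
    have "tower x 0 \<le> tower x 2"
      using anti[OF le1[of 1]] x0 by (simp add: eval_nat_numeral)
    then show ?case using anti[of "tower x 0" "tower x 2"] by (simp add: eval_nat_numeral)
  next
    case (Suc n)
    then have "tower x (2 * Suc n) \<le> tower x (2 * Suc (Suc n))"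
      using anti[of "tower x (2 * Suc n + 1)" "tower x (2 * n + 1)"] by simp
    then show ?case using anti[of "tower x (2 * Suc n)" "tower x (2 * Suc (Suc n))"] by simp
  qed
  define E where "E = (\<lambda>n. tower x (2 * n))"
  define D where "D = (\<lambda>n. tower x (2 * n + 1))"
  have incE: "incseq E" unfolding E_def using even_odd by (intro incseq_SucI) auto
  have decD: "decseq D" unfolding D_def using even_odd by (intro decseq_SucI) auto
  obtain p where p: "E \<longlonglongrightarrow> p"
    by (rule incseq_convergent[OF incE, of 1]) (auto simp: E_def intro: le1)
  obtain q where q: "D \<longlonglongrightarrow> q"
    by (rule decseq_convergent[OF decD, of 0]) (auto simp: D_def intro: less_imp_le[OF pos])
  have Dp: "D \<longlonglongrightarrow> x powr p"
    using tendsto_powr[OF tendsto_const p, of x] x0 by (simp add: D_def E_def)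
  have "(\<lambda>n. E (Suc n)) \<longlonglongrightarrow> x powr q"
    using tendsto_powr[OF tendsto_const q, of x] x0 by (simp add: D_def E_def)
  then have fix_p: "x powr q = p" using LIMSEQ_Suc[OF p] by (rule LIMSEQ_unique)
  have fix_q: "x powr p = q" using Dp q by (rule LIMSEQ_unique)
  have "p = q"
    by (rule powr_powr_fixed_point_unique[OF x]) (simp_all only: fix_p fix_q)
  have "tower x \<longlonglongrightarrow> p"
    using p q[folded \<open>p = q\<close>] unfolding E_def D_def by (rule LIMSEQ_even_odd)
  moreover have "p > 0" using x0 unfolding fix_p[symmetric] by simp
  moreover have "p \<le> 1" by (rule LIMSEQ_le_const2[OF p]) (auto simp: E_def intro: le1)
  ultimately show ?thesis by blast
qed

section \<open>The limit function as the inverse of r^(1/r)\<close>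

lemma ln_div_self_strict_mono:
  fixes r s :: real
  assumes "0 < r" "r < s" "s \<le> exp 1"
  shows "ln r / r < ln s / s"
proof -
  have "ln (r / s) < r / s - 1"
    using assms ln_le_minus_one[of "r / s"] ln_eq_minus_one[of "r / s"] by (force simp: less_le)
  then have "s * (ln r - ln s) < r - s"
    using assms by (simp add: ln_div field_simps)
  moreover have "ln s \<le> 1"
    using assms ln_mono[of s "exp 1"] by simp
  then have "(s - r) * ln s \<le> s - r"
    using assms by (simp add: mult_left_le)
  ultimately have "s * ln r < r * ln s" by (simp add: algebra_simps)
  then show ?thesis using assms by (simp add: field_simps)
qed

lemma h_properties:
  assumes x: "exp (- exp 1) \<le> x" "x \<le> exp (1 / exp 1)"
  shows "1 / exp 1 \<le> h x" "h x \<le> exp 1" "x powr h x = h x"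
proof -
  have x0: "x > 0" using x(1) exp_gt_zero less_le_trans by blast
  obtain L where L: "tower x \<longlonglongrightarrow> L" "0 < L" "L \<le> exp 1"
  proof (cases "x \<ge> 1")
    case True
    with tower_converges_ge_1[OF True x(2)] that show ?thesis by force
  next
    case False
    then obtain L where "tower x \<longlonglongrightarrow> L" "0 < L" "L \<le> 1"
      using tower_converges_lt_1[OF x(1)] by auto
    moreover have "L \<le> exp 1" using \<open>L \<le> 1\<close> one_le_exp_iff[of 1] by (meson order.trans zero_le_one)
    ultimately show ?thesis using that by blast
  qed
  have h: "h x = L" unfolding h_def using L(1) by (rule limI)
  have "(\<lambda>n. tower x (Suc n)) \<longlonglongrightarrow> x powr L"
    using tendsto_powr[OF tendsto_const L(1), of x] x0 by simp
  with LIMSEQ_Suc[OF L(1)] have fixp: "x powr L = L" by (rule LIMSEQ_unique[symmetric])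
  then show "x powr h x = h x" "h x \<le> exp 1" using L(3) by (simp_all add: h)
  have ln: "ln x = ln L / L" using arg_cong[OF fixp, of ln] x0 L(2) by (simp add: ln_powr field_simps)
  show "1 / exp 1 \<le> h x"
  proof (rule ccontr)
    assume "\<not> ?thesis"
    then have "ln L / L < ln (1 / exp 1) / (1 / exp 1)"
      using L order.trans[of "1 / exp 1" 1 "exp (1::real)"]
      by (intro ln_div_self_strict_mono) (auto simp: h)
    then have "ln x < - exp 1" by (simp add: ln ln_div)
    then show False using x(1) x0 ln_mono[of "exp (- exp 1)" x] by simp
  qed
qed

text \<open>The fixed point equation for the limit s reads \<open>ln s / s = ln r / r\<close>. Both
  numbers are at most e, the range on which this function is strictly increasing. Beyond e
  injectivity fails: \<open>2 powr (1 / 2) = 4 powr (1 / 4)\<close>.\<close>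

lemma h_self_root:
  assumes r: "1 / exp 1 \<le> r" "r \<le> exp 1"
  shows "exp (- exp 1) \<le> r powr (1 / r)" "r powr (1 / r) \<le> exp (1 / exp 1)" "h (r powr (1 / r)) = r"
proof -
  have r0: "r > 0" using r(1) by (meson divide_pos_pos exp_gt_zero less_le_trans zero_less_one)
  have mono: "ln s / s \<le> ln t / t" if "0 < s" "s \<le> t" "t \<le> exp 1" for s t :: real
    using ln_div_self_strict_mono[of s t] that by (cases "s = t") auto
  show *: "exp (- exp 1) \<le> r powr (1 / r)" "r powr (1 / r) \<le> exp (1 / exp 1)"
    using mono[of "1 / exp 1" r] mono[of r "exp 1"] r r0 by (simp_all add: powr_def ln_div)
  note h = h_properties[OF *]
  define s where "s = h (r powr (1 / r))"
  have s0: "s > 0" using h(1) by (simp add: s_def) (meson divide_pos_pos exp_gt_zero less_le_trans zero_less_one)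
  have "s / r * ln r = ln s"
    using arg_cong[OF h(3), of ln] r0 by (simp add: s_def ln_powr)
  then have eq: "ln r / r = ln s / s" using r0 s0 by (simp add: field_simps)
  have "s \<le> exp 1" using h(2) by (simp add: s_def)
  then have "s = r"
    using ln_div_self_strict_mono[of r s] ln_div_self_strict_mono[of s r] r0 s0 r(2) eq
    by (cases r s rule: linorder_cases) auto
  then show "h (r powr (1 / r)) = r" by (simp add: s_def)
qed

section \<open>Parametrisation by coprime pairs\<close>

lemma alg_ord_eq_enat_iff:
  "alg_ord A = enat k \<longleftrightarrow> k \<ge> 1 \<and> A ^ k \<in> \<rat> \<and> (\<forall>j\<ge>1. A ^ j \<in> \<rat> \<longrightarrow> k \<le> j)"
proof
  assume ord: "alg_ord A = enat k"
  define P where "P = (\<lambda>n::nat. n \<ge> 1 \<and> A ^ n \<in> \<rat>)"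
  have ex: "\<exists>n. P n" and k: "k = (LEAST n. P n)"
    using ord by (auto simp: alg_ord_def P_def split: if_splits)
  then show "k \<ge> 1 \<and> A ^ k \<in> \<rat> \<and> (\<forall>j\<ge>1. A ^ j \<in> \<rat> \<longrightarrow> k \<le> j)"
    using LeastI_ex[OF ex] Least_le[of P] by (auto simp: P_def)
next
  assume *: "k \<ge> 1 \<and> A ^ k \<in> \<rat> \<and> (\<forall>j\<ge>1. A ^ j \<in> \<rat> \<longrightarrow> k \<le> j)"
  then have "(LEAST n. n \<ge> 1 \<and> A ^ n \<in> \<rat>) = k"
    by (intro Least_equality) auto
  then show "alg_ord A = enat k" using * by (auto simp: alg_ord_def)
qed

text \<open>Exponents with a rational power are closed under remainders modulo \<open>k\<close>, so
  minimality of \<open>k\<close> makes the remainder 0.\<close>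

lemma alg_ord_dvd:
  assumes ord: "alg_ord A = enat k" and A: "A \<noteq> 0" "A ^ n \<in> \<rat>"
  shows "k dvd n"
proof -
  have k: "k \<ge> 1" "A ^ k \<in> \<rat>" "\<And>j. j \<ge> 1 \<Longrightarrow> A ^ j \<in> \<rat> \<Longrightarrow> k \<le> j"
    using ord by (auto simp: alg_ord_eq_enat_iff)
  have "A ^ n = A ^ (n mod k) * (A ^ k) ^ (n div k)"
    by (metis mod_mult_div_eq power_add power_mult)
  then have "A ^ (n mod k) = A ^ n / (A ^ k) ^ (n div k)" using A(1) by simp
  then have "A ^ (n mod k) \<in> \<rat>" using A(2) k(2) by simp
  with k(3)[of "n mod k"] k(1) have "n mod k = 0"
    by (meson less_one linorder_not_le mod_less_divisor order.strict_trans2)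
  then show ?thesis by (simp add: dvd_eq_mod_eq_0)
qed

lemma algebraic_of_power_rational:
  fixes A :: real
  assumes "k > 0" "A ^ k \<in> \<rat>"
  shows "algebraic A"
proof (rule algebraicI')
  show "coeff (monom 1 k - [:A ^ k:]) i \<in> \<rat>" for i
    using assms by (auto simp: coeff_pCons split: nat.splits)
  have "coeff (monom 1 k - [:A ^ k:]) k = 1"
    using assms(1) by (cases k) auto
  then show "monom 1 k - [:A ^ k:] \<noteq> 0" by (metis coeff_0 zero_neq_one)
  show "poly (monom 1 k - [:A ^ k:]) A = 0" by (simp add: poly_monom)
qed

text \<open>Comparing multiplicities of a prime p, \<open>g\<close> divides
  \<open>n * multiplicity p m\<close> and is coprime to \<open>n\<close>, so it divides every
  multiplicity in \<open>m\<close>.\<close>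

lemma is_nth_power_of_coprime_exponent:
  fixes a m g n :: nat
  assumes "a ^ g = m ^ n" "coprime g n" "m > 0" "g > 0"
  shows "\<exists>u. m = u ^ g"
proof -
  have a: "a > 0" using assms(1,3) zero_less_power[of m n] by (metis assms(4) gr0I power_eq_0_iff)
  have "g dvd multiplicity p m" if p: "prime p" for p
  proof -
    have "g * multiplicity p a = n * multiplicity p m"
      using arg_cong[OF assms(1), of "multiplicity p"] p a assms(3)
      by (simp add: prime_elem_multiplicity_power_distrib)
    then have "g dvd n * multiplicity p m" by (metis dvd_triv_left)
    then show ?thesis using assms(2) by (simp add: coprime_dvd_mult_right_iff)
  qed
  then have "is_nth_power g m"
    using assms(3,4) by (subst is_nth_power_conv_multiplicity_nat) auto
  then show ?thesis by (auto elim: is_nth_powerE)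
qed

section \<open>Roots of coprime ratios and their orders\<close>

definition root_of_ratio :: "nat \<times> nat \<Rightarrow> real" where
  "root_of_ratio = (\<lambda>(m, n). (real m / real n) powr (real n / real m))"

lemma root_of_ratio_pos: "m > 0 \<Longrightarrow> n > 0 \<Longrightarrow> root_of_ratio (m, n) > 0"
  by (simp add: root_of_ratio_def)

lemma root_of_ratio_power:
  assumes "m > 0" "n > 0"
  shows "root_of_ratio (m, n) ^ m = (real m / real n) ^ n"
proof -
  have "root_of_ratio (m, n) ^ m = root_of_ratio (m, n) powr real m"
    using root_of_ratio_pos[OF assms] by (simp add: powr_realpow)
  also have "\<dots> = (real m / real n) powr real n"
    using assms by (simp add: root_of_ratio_def powr_powr)
  also have "\<dots> = (real m / real n) ^ n" using assms by (simp add: powr_realpow)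
  finally show ?thesis .
qed

text \<open>If the j-th power is a/b in lowest terms, then (a/b)^g = (m/n)^n, and both sides are in
  lowest terms. Hence a^g = m^n and b^g = n^n. Since \<open>g\<close> divides \<open>m\<close>, it
  is coprime to \<open>n\<close>, and so \<open>m\<close> and \<open>n\<close> are themselves g-th
  powers.\<close>

lemma root_of_ratio_perfect_power:
  assumes mn: "coprime m n" "m > 0" "n > 0" and A: "root_of_ratio (m, n) ^ j \<in> \<rat>" and m: "m = j * g"
  shows "\<exists>u v. m = u ^ g \<and> n = v ^ g \<and> coprime u v"
proof -
  define A where "A = root_of_ratio (m, n)"
  have g0: "g > 0" using mn(2) m by auto
  obtain a b :: nat where ab: "b \<noteq> 0" "\<bar>A ^ j\<bar> = real a / real b" "coprime a b"
    using Rats_abs_nat_div_natE[of "A ^ j"] assms(4) unfolding A_def by metis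
  have "A > 0" using root_of_ratio_pos mn by (simp add: A_def)
  then have Aj: "A ^ j = real a / real b" using ab(2) by simp
  have "(real a / real b) ^ g = (real m / real n) ^ n"
    using root_of_ratio_power[OF mn(2,3)] unfolding Aj[symmetric] m A_def[symmetric]
    by (simp add: A_def m power_mult)
  then have "real (a ^ g * n ^ n) = real (m ^ n * b ^ g)"
    using ab(1) mn(3) by (simp add: field_simps)
  then have eq: "a ^ g * n ^ n = m ^ n * b ^ g" by (simp only: of_nat_eq_iff)
  have cop: "coprime (a ^ g) (b ^ g)" "coprime (m ^ n) (n ^ n)" using ab(3) mn(1) by auto
  have "a ^ g = m ^ n \<and> b ^ g = n ^ n"
  proof
    have "a ^ g dvd m ^ n" "m ^ n dvd a ^ g"
      using eq cop by (metis coprime_dvd_mult_left_iff dvd_triv_left)+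
    then show 1: "a ^ g = m ^ n" by (rule dvd_antisym)
    then show "b ^ g = n ^ n" using eq mn(2) by simp
  qed
  moreover have "coprime g n" using mn(1) m by (meson coprime_divisors dvd_refl dvd_triv_right)
  ultimately obtain u v where uv: "m = u ^ g" "n = v ^ g"
    using is_nth_power_of_coprime_exponent mn g0 by metis
  then have "coprime u v" using mn(1) g0 by (simp add: coprime_power_left_iff coprime_power_right_iff)
  with uv show ?thesis by blast
qed

definition ratio_pairs :: "nat \<Rightarrow> (nat \<times> nat) set" where
  "ratio_pairs k = {(m, n). m > 0 \<and> n > 0 \<and> coprime m n \<and> real n \<le> exp 1 * real m
     \<and> real m \<le> exp 1 * real n \<and> alg_ord (root_of_ratio (m, n)) = enat k}"

lemma h_algebraic_imp_rational:
  assumes A: "exp (- exp 1) \<le> A" "A \<le> exp (1 / exp 1)" "algebraic (h A)" "alg_ord A = enat k"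
  shows "h A \<in> \<rat>"
proof -
  have A0: "A > 0" using A(1) exp_gt_zero less_le_trans by blast
  have k: "k \<ge> 1" "A ^ k \<in> \<rat>" using A(4) by (auto simp: alg_ord_eq_enat_iff)
  note fixp = h_properties(3)[OF A(1,2)]
  show ?thesis
  proof (cases "A = 1")
    case True
    then show ?thesis using fixp by simp
  next
    case False
    have "A ^ k \<noteq> 1"
      using False A0 k(1) by (metis power_eq_1_iff abs_of_pos not_one_le_zero real_norm_def)
    moreover have "(A ^ k) powr h A = int_poly_eval (monom 1 k) (h A)"
    proof -
      have "(A ^ k) powr h A = (A powr h A) ^ k"
        using A0 by (simp add: powr_power powr_powr powr_realpow[symmetric] mult.commute)
      also have "\<dots> = int_poly_eval (monom 1 k) (h A)"
        by (simp add: fixp int_poly_eval_def map_poly_monom poly_monom)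
      finally show ?thesis .
    qed
    ultimately show ?thesis
      using gelfond_schneider_rational_base[of "A ^ k" "h A" "monom 1 k"] A0 A(3) k(2) by simp
  qed
qed

lemma Q_eq_card_ratio_pairs:
  assumes k: "k > 0"
  shows "Q k = card (ratio_pairs k)"
proof -
  define S where "S = {A::real. algebraic A \<and> A \<in> {exp (- exp 1) .. exp (1 / exp 1)}
                 \<and> algebraic (h A) \<and> alg_ord A = enat k}"
  have bounds: "1 / exp 1 \<le> real m / real n \<and> real m / real n \<le> exp 1 \<longleftrightarrow>
      real n \<le> exp 1 * real m \<and> real m \<le> exp 1 * real n" if "m > 0" "n > 0" for m n
    using that by (simp add: field_simps)
  have h_root: "exp (- exp 1) \<le> root_of_ratio (m, n)" "root_of_ratio (m, n) \<le> exp (1 / exp 1)"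
    "h (root_of_ratio (m, n)) = real m / real n" if "(m, n) \<in> ratio_pairs k" for m n
    using h_self_root[of "real m / real n"] bounds[of m n] that
    by (auto simp: ratio_pairs_def root_of_ratio_def)
  have "inj_on root_of_ratio (ratio_pairs k)"
  proof (rule inj_onI, clarify)
    fix m n m' n' assume mn: "(m, n) \<in> ratio_pairs k" "(m', n') \<in> ratio_pairs k"
      and "root_of_ratio (m, n) = root_of_ratio (m', n')"
    then have "real m / real n = real m' / real n'" using h_root(3) by metis
    moreover have pos: "m > 0" "n > 0" "m' > 0" "n' > 0" and cop: "coprime m n" "coprime m' n'"
      using mn by (auto simp: ratio_pairs_def)
    ultimately have "real (m * n') = real (m' * n)" by (simp add: field_simps)
    then have "m * n' = m' * n" by (simp only: of_nat_eq_iff)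
    with cop show "m = m' \<and> n = n'"
      using coprime_crossproduct_nat[of m n m' n'] by (simp add: mult.commute)
  qed
  moreover have "root_of_ratio ` ratio_pairs k = S"
  proof (intro equalityI subsetI)
    fix A assume "A \<in> root_of_ratio ` ratio_pairs k"
    then obtain m n where mn: "(m, n) \<in> ratio_pairs k" "A = root_of_ratio (m, n)" by auto
    have ord: "alg_ord A = enat k" using mn by (auto simp: ratio_pairs_def)
    have "algebraic A"
      using ord k by (intro algebraic_of_power_rational[of k]) (auto simp: alg_ord_eq_enat_iff)
    moreover have "algebraic (h A)"
      using h_root(3)[OF mn(1)] mn(2) by (auto intro!: rat_imp_algebraic)
    ultimately show "A \<in> S" using h_root[OF mn(1)] ord by (auto simp: S_def mn(2))
  next
    fix A assume "A \<in> S"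
    then have A: "exp (- exp 1) \<le> A" "A \<le> exp (1 / exp 1)" "algebraic (h A)" "alg_ord A = enat k"
      by (auto simp: S_def)
    have A0: "A > 0" using A(1) exp_gt_zero less_le_trans by blast
    note h = h_properties[OF A(1,2)]
    have h0: "h A > 0" using h(3) A0 by (metis powr_gt_zero less_irrefl)
    obtain m n :: nat where mn: "n \<noteq> 0" "\<bar>h A\<bar> = real m / real n" "coprime m n"
      using Rats_abs_nat_div_natE[OF h_algebraic_imp_rational[OF A]] by metis
    then have hA: "h A = real m / real n" using h0 by simp
    then have m0: "m > 0" using h0 by (cases m) auto
    have "A = (A powr h A) powr (1 / h A)" using A0 h0 by (simp add: powr_powr)
    also have "\<dots> = root_of_ratio (m, n)" unfolding h(3) by (simp add: hA root_of_ratio_def)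
    finally have "A = root_of_ratio (m, n)" .
    moreover have "(m, n) \<in> ratio_pairs k"
      using mn m0 A(4) h(1,2)[unfolded hA] bounds[of m n] calculation by (auto simp: ratio_pairs_def)
    ultimately show "A \<in> root_of_ratio ` ratio_pairs k" by blast
  qed
  ultimately show ?thesis unfolding Q_def S_def[symmetric] by (metis card_image)
qed

section \<open>Counting\<close>

lemma card_multiples:
  fixes p :: nat and x :: real
  assumes "p > 0"
  shows "card {n. n > 0 \<and> real n \<le> x \<and> p dvd n \<and> R n} = card {n. n > 0 \<and> real n \<le> x / p \<and> R (p * n)}"
proof -
  have "{n. n > 0 \<and> real n \<le> x \<and> p dvd n \<and> R n} = (\<lambda>n. p * n) ` {n. n > 0 \<and> real n \<le> x / p \<and> R (p * n)}"
    using assms by (auto simp: field_simps elim!: dvdE)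
  moreover have "inj_on (\<lambda>n. p * n) {n. n > 0 \<and> real n \<le> x / p \<and> R (p * n)}"
    using assms by (auto intro: inj_onI)
  ultimately show ?thesis by (simp add: card_image)
qed

lemma finite_nat_real_le: "finite {n::nat. real n \<le> x \<and> R n}"
proof (rule finite_subset)
  show "{n::nat. real n \<le> x \<and> R n} \<subseteq> {..nat \<lfloor>x\<rfloor>}" by (auto simp: le_nat_floor)
qed simp

text \<open>Adding a prime p subtracts the count for \<open>P\<close> at \<open>x / p\<close> from
  the count at \<open>x\<close>: divisibility of p n by another prime of \<open>P\<close> is
  divisibility of n. Main terms subtract in the same way, and the two errors add, which doubles the
  bound. For empty \<open>P\<close> the error is that of rounding \<open>x\<close> down.\<close>

lemma legendre_sieve:
  fixes x :: real and P :: "nat set"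
  assumes "finite P" "\<And>p. p \<in> P \<Longrightarrow> prime p" "x \<ge> 0"
  shows "\<bar>real (card {n. n > 0 \<and> real n \<le> x \<and> (\<forall>p\<in>P. \<not> p dvd n)}) - x * (\<Prod>p\<in>P. 1 - 1 / real p)\<bar> \<le> 2 ^ card P"
  using assms
proof (induction P arbitrary: x rule: finite_induct)
  case empty
  have "{n. n > 0 \<and> real n \<le> x} = {1..nat \<lfloor>x\<rfloor>}"
    using empty by (auto simp: le_nat_floor Suc_le_eq le_nat_iff le_floor_iff)
  then show ?case using empty by simp linarith
next
  case (insert p P)
  define N where "N = (\<lambda>y::real. {n. n > 0 \<and> real n \<le> y \<and> (\<forall>q\<in>P. \<not> q dvd n)})"
  have p: "prime p" "p > 0" using insert.prems by (auto simp: prime_gt_0_nat)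
  have fin: "finite (N y)" for y
    by (rule finite_subset[OF _ finite_nat_real_le[of y "\<lambda>_. True"]]) (auto simp: N_def)
  define D where "D = {n. n > 0 \<and> real n \<le> x \<and> p dvd n \<and> (\<forall>q\<in>P. \<not> q dvd n)}"
  have "q dvd p * n \<longleftrightarrow> q dvd n" if "q \<in> P" for q n
  proof -
    have "prime q" "q \<noteq> p" using that insert by auto
    then show ?thesis using p(1) by (metis prime_dvd_mult_iff primes_dvd_imp_eq)
  qed
  then have D: "card D = card (N (x / p))"
    unfolding D_def N_def card_multiples[OF p(2)] by (intro arg_cong[where f = card]) auto
  have "{n. n > 0 \<and> real n \<le> x \<and> (\<forall>q\<in>insert p P. \<not> q dvd n)} = N x - D"
    by (auto simp: N_def D_def)
  moreover have "D \<subseteq> N x" by (auto simp: N_def D_def)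
  moreover from this have "card D \<le> card (N x)" using fin by (rule card_mono[rotated])
  ultimately have "real (card {n. n > 0 \<and> real n \<le> x \<and> (\<forall>q\<in>insert p P. \<not> q dvd n)})
      = real (card (N x)) - real (card (N (x / p)))"
    using fin[of x] D by (simp add: card_Diff_subset finite_subset of_nat_diff)
  moreover have "x * (\<Prod>q\<in>insert p P. 1 - 1 / real q)
      = x * (\<Prod>q\<in>P. 1 - 1 / real q) - x / p * (\<Prod>q\<in>P. 1 - 1 / real q)"
    using insert by (simp add: algebra_simps)
  moreover have "\<bar>real (card (N x)) - x * (\<Prod>q\<in>P. 1 - 1 / real q)\<bar> \<le> 2 ^ card P"
    "\<bar>real (card (N (x / p))) - x / p * (\<Prod>q\<in>P. 1 - 1 / real q)\<bar> \<le> 2 ^ card P"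
    unfolding N_def by (rule insert.IH; use insert.prems in simp)+
  ultimately show ?case using insert by simp
qed

lemma coprime_iff_prime_factors:
  fixes n k :: nat
  assumes "k > 0"
  shows "coprime n k \<longleftrightarrow> (\<forall>p\<in>prime_factors k. \<not> p dvd n)"
proof
  assume coprime: "coprime n k"
  show "\<forall>p\<in>prime_factors k. \<not> p dvd n"
  proof (intro ballI notI)
    fix p assume p: "p \<in> prime_factors k" "p dvd n"
    then have "is_unit p"
      using coprime_common_divisor[OF coprime p(2)] by (simp add: in_prime_factors_iff)
    then show False using p(1) by (simp add: in_prime_factors_iff)
  qed
next
  assume *: "\<forall>p\<in>prime_factors k. \<not> p dvd n"
  show "coprime n k"
  proof (rule ccontr)
    assume "\<not> coprime n k"
    then have "gcd n k \<noteq> 1" by (simp add: coprime_iff_gcd_eq_1)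
    from prime_factor_nat[OF this] obtain p where "prime p" "p dvd gcd n k" by blast
    then have "p \<in> prime_factors k" "p dvd n" using assms by (simp_all add: in_prime_factors_iff)
    with * show False by blast
  qed
qed

lemma card_coprime_approx:
  fixes x :: real
  assumes k: "k > 0" and x: "x \<ge> 0"
  shows "\<bar>real (card {n. n > 0 \<and> real n \<le> x \<and> coprime n k}) - x * (totient k / k)\<bar>
           \<le> 2 ^ card (prime_factors k)"
proof -
  have "totient k / k = (\<Prod>p\<in>prime_factors k. 1 - 1 / real p)"
    using k by (simp add: totient_formula2)
  then show ?thesis
    using legendre_sieve[of "prime_factors k" x] x k by (auto simp: coprime_iff_prime_factors)
qed

text \<open>A difference of two sieve counts, up to e k and up to k/e. The range is closed at k/e,
  so a number equal to k/e must not be subtracted. Allowing for one such number avoids arguing that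
  k/e is irrational; this and the two sieve errors account for the factor 3.\<close>

lemma card_coprime_ratio_range:
  assumes k: "k > 1"
  defines "S \<equiv> {n. n > 0 \<and> coprime n k \<and> real n \<le> exp 1 * real k \<and> real k \<le> exp 1 * real n}"
  shows "\<bar>real (card S) - (exp 1 - 1 / exp 1) * totient k\<bar> \<le> 3 * 2 ^ card (prime_factors k)"
proof -
  define N where "N = (\<lambda>y::real. {n. n > 0 \<and> real n \<le> y \<and> coprime n k})"
  define \<omega> where "\<omega> = card (prime_factors k)"
  have fin: "finite (N y)" for y
    by (rule finite_subset[OF _ finite_nat_real_le[of y "\<lambda>_. True"]]) (auto simp: N_def)
  define y where "y = real k / exp 1"
  define E where "E = N y - {n. real n = y}"
  have "1 / exp 1 \<le> exp (1::real)" by (rule order.trans[of _ 1]) auto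
  then have y_le: "y \<le> exp 1 * real k" using k by (simp add: y_def field_simps mult_le_cancel_left)
  have S: "n \<in> S \<longleftrightarrow> n \<in> N (exp 1 * real k) \<and> y \<le> real n" for n
    by (auto simp: S_def N_def y_def field_simps)
  have E: "n \<in> E \<longleftrightarrow> n \<in> N (exp 1 * real k) \<and> real n < y" for n
    using y_le by (auto simp: E_def N_def)
  have "N (exp 1 * real k) = S \<union> E" "S \<inter> E = {}"
    unfolding set_eq_iff Un_iff Int_iff S E by auto
  then have "card (N (exp 1 * real k)) = card S + card E"
    using fin[of "exp 1 * real k"] by (simp add: card_Un_disjoint)
  moreover have "card E \<le> card (N y)" unfolding E_def using fin by (intro card_mono) auto
  moreover have "card (N y) \<le> card E + 1"
  proof -
    have "N y \<subseteq> insert (nat \<lfloor>y\<rfloor>) E" by (auto simp: E_def)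
    then have "card (N y) \<le> card (insert (nat \<lfloor>y\<rfloor>) E)"
      using fin by (intro card_mono) (auto simp: E_def)
    also have "\<dots> \<le> card E + 1" by (simp add: card_insert_if fin E_def)
    finally show ?thesis .
  qed
  moreover have "\<bar>real (card (N (exp 1 * real k))) - exp 1 * real k * (totient k / k)\<bar> \<le> 2 ^ \<omega>"
    "\<bar>real (card (N y)) - y * (totient k / k)\<bar> \<le> 2 ^ \<omega>"
    unfolding N_def \<omega>_def by (rule card_coprime_approx; use k in \<open>simp add: y_def\<close>)+
  moreover have "exp 1 * real k * (totient k / k) = exp 1 * totient k"
    "y * (totient k / k) = 1 / exp 1 * totient k"
    using k by (simp_all add: y_def)
  moreover define c where "c = (2::real) ^ \<omega>"
  moreover have "1 \<le> c" by (simp add: c_def)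
  ultimately show ?thesis unfolding \<omega>_def[symmetric] c_def[symmetric] by (simp add: left_diff_distrib)
qed

text \<open>The product of \<open>f p\<close> over the primes dividing k is at most
  \<open>totient k / (sqrt k * 2 ^ \<omega>)\<close>, with \<omega> the number of these primes. A
  factor is at least 1 once p is at least 7, because sqrt 7 is at least 7/3 and 7/3 times 6/7 is 2.
  Smaller primes give at least 1/4 each.\<close>

lemma two_power_omega_le:
  assumes k: "k > 0"
  shows "2 ^ card (prime_factors k) * sqrt (real k) \<le> 4 ^ 7 * real (totient k)"
proof -
  define f where "f = (\<lambda>p::nat. sqrt (real p) * (1 - 1 / real p) / 2)"
  define P where "P = prime_factors k"
  have f_small: "f p \<ge> 1 / 4" if "p \<ge> 2" for p
  proof -
    have "1 * (1 / 2) \<le> sqrt (real p) * (1 - 1 / real p)"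
      using that by (intro mult_mono) (auto simp: field_simps)
    then show ?thesis by (simp add: f_def)
  qed
  have f_large: "f p \<ge> 1" if "p \<ge> 7" for p
  proof -
    have "sqrt (real p) \<ge> 7 / 3" using that by (intro real_le_rsqrt) (auto simp: power2_eq_square)
    moreover have "1 - 1 / real p \<ge> 6 / 7" using that by (simp add: field_simps)
    ultimately have "7 / 3 * (6 / 7) \<le> sqrt (real p) * (1 - 1 / real p)"
      by (intro mult_mono) auto
    then show ?thesis by (simp add: f_def)
  qed
  have P: "finite P" "\<And>p. p \<in> P \<Longrightarrow> p \<ge> 2"
    using prime_ge_2_nat by (auto simp: P_def in_prime_factors_iff)
  have "(1 / 4) ^ 7 \<le> (\<Prod>p\<in>P. f p)"
  proof -
    \<comment> \<open>A crude count: at most the seven numbers below 7 can contribute a factor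
      1/4.\<close>
    have "(1 / 4) ^ 7 \<le> (1 / 4 :: real) ^ card (P \<inter> {..<7})"
      using card_mono[of "{..<7::nat}" "P \<inter> {..<7}"] by (intro power_decreasing) auto
    also have "\<dots> = (\<Prod>p\<in>P. if p < 7 then 1 / 4 else 1)"
      using P(1) by (subst prod.If_cases) (auto simp: Collect_conj_eq lessThan_def)
    also have "\<dots> \<le> (\<Prod>p\<in>P. f p)"
      using P f_small f_large by (intro prod_mono) auto
    finally show ?thesis .
  qed
  also have "(\<Prod>p\<in>P. f p) = (\<Prod>p\<in>P. sqrt (real p)) * (\<Prod>p\<in>P. 1 - 1 / real p) / 2 ^ card P"
    by (simp add: f_def prod.distrib prod_dividef)
  also have "(\<Prod>p\<in>P. sqrt (real p)) = sqrt (real (\<Prod>P))"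
    by (induction P rule: infinite_finite_induct) (auto simp: real_sqrt_mult)
  also have "sqrt (real (\<Prod>P)) * (\<Prod>p\<in>P. 1 - 1 / real p) / 2 ^ card P
      \<le> sqrt (real k) * (\<Prod>p\<in>P. 1 - 1 / real p) / 2 ^ card P"
  proof (intro divide_right_mono mult_right_mono)
    have "\<Prod>P dvd (\<Prod>p\<in>P. p ^ multiplicity p k)"
      by (intro prod_dvd_prod) (auto simp: P_def prime_factors_multiplicity)
    also have "\<dots> = k"
      using k unfolding P_def by (intro Primes.prime_factorization_nat[symmetric])
    finally have "\<Prod>P \<le> k" using k by (simp add: dvd_imp_le)
    then show "sqrt (real (\<Prod>P)) \<le> sqrt (real k)"
      by (intro real_sqrt_le_mono) (simp only: of_nat_le_iff)
    show "0 \<le> (\<Prod>p\<in>P. 1 - 1 / real p)" using P(2) by (intro prod_nonneg) (fastforce simp: field_simps)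
  qed simp
  also have "(\<Prod>p\<in>P. 1 - 1 / real p) = totient k / k"
    using k by (simp add: totient_formula2 P_def)
  also have "sqrt (real k) * (totient k / k) = totient k / sqrt (real k)"
  proof -
    have "totient k / sqrt (real k) = (totient k * sqrt (real k)) / (sqrt (real k) * sqrt (real k))"
      using k by (intro nonzero_mult_divide_mult_cancel_right[symmetric]) simp
    then show ?thesis by (simp add: mult.commute)
  qed
  finally have "(1 / 4) ^ 7 \<le> totient k / sqrt (real k) / 2 ^ card P" .
  then show ?thesis using k by (simp add: P_def field_simps)
qed

section \<open>Exceptional pairs of perfect powers\<close>

definition perfect_power_partners :: "nat \<Rightarrow> nat \<Rightarrow> nat set" where
  "perfect_power_partners g m =
     {n. \<exists>u v. m = u ^ g \<and> n = v ^ g \<and> coprime u v \<and> n > 0 \<and> real n \<le> exp 1 * real m}"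

text \<open>Coprimality to \<open>u\<close> has period \<open>u\<close>, and the range consists of
  two periods. For \<open>u > 1\<close> the residue 0 is not coprime to \<open>u\<close>, so one
  period is exactly \<open>totatives u\<close>.\<close>

lemma card_coprime_below_double:
  assumes "u > 1"
  shows "card {v. v < 2 * u \<and> coprime u v} \<le> 2 * totient u"
proof -
  have tot: "card {v. v < u \<and> coprime u v} = totient u"
  proof -
    have "{v. v < u \<and> coprime u v} = totatives u"
      using assms by (auto simp: totatives_def coprime_commute order_le_less intro: gr0I)
    then show ?thesis by (simp add: totient_def)
  qed
  have "{v. v < 2 * u \<and> coprime u v} \<subseteq> {v. v < u \<and> coprime u v} \<union> (\<lambda>v. u + v) ` {v. v < u \<and> coprime u v}"
  proof
    fix v assume v: "v \<in> {v. v < 2 * u \<and> coprime u v}"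
    show "v \<in> {v. v < u \<and> coprime u v} \<union> (\<lambda>v. u + v) ` {v. v < u \<and> coprime u v}"
    proof (cases "v < u")
      case False
      then obtain w where w: "v = u + w" by (metis le_Suc_ex not_less)
      with v have "w < u" "coprime u w" by (auto simp: coprime_iff_gcd_eq_1)
      with w show ?thesis by blast
    qed (use v in auto)
  qed
  then have "card {v. v < 2 * u \<and> coprime u v}
      \<le> card ({v. v < u \<and> coprime u v} \<union> (\<lambda>v. u + v) ` {v. v < u \<and> coprime u v})"
    by (intro card_mono) auto
  also have "\<dots> \<le> totient u + card ((\<lambda>v. u + v) ` {v. v < u \<and> coprime u v})"
    using card_Un_le tot by metis
  also have "\<dots> \<le> totient u + totient u"
    using card_image_le[of "{v. v < u \<and> coprime u v}" "\<lambda>v. u + v"] tot by simp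
  finally show ?thesis by simp
qed

text \<open>Applied with \<open>m = k\<close> to pairs whose order is a proper divisor of k, and
  with \<open>m = k * g\<close> to pairs of order k with a larger numerator. The geometric factor
  makes the bounds summable over \<open>g\<close>.\<close>

lemma card_perfect_power_partners:
  assumes m: "m > 1" and g: "g \<ge> 2"
  shows "finite (perfect_power_partners g m)"
    and "real (card (perfect_power_partners g m)) \<le> 4 * (1 / sqrt 2) ^ g * (totient m / sqrt m)"
proof -
  have "finite (perfect_power_partners g m) \<and>
    real (card (perfect_power_partners g m)) \<le> 4 * (1 / sqrt 2) ^ g * (totient m / sqrt m)"
  proof (cases "\<exists>u. m = u ^ g")
    case False
    then have "perfect_power_partners g m = {}" by (auto simp: perfect_power_partners_def)
    then show ?thesis by simp
  next
    case True
    then obtain u where u: "m = u ^ g" by blast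
    have u2: "u \<ge> 2"
    proof (rule ccontr)
      assume "\<not> u \<ge> 2"
      then have "u = 0 \<or> u = 1" by auto
      then show False using u m g by (auto simp: power_0_left)
    qed
    define V where "V = {v. v < 2 * u \<and> coprime u v}"
    have sub: "perfect_power_partners g m \<subseteq> (\<lambda>v. v ^ g) ` V"
    proof
      fix n assume "n \<in> perfect_power_partners g m"
      then obtain u' v where uv: "m = u' ^ g" "n = v ^ g" "coprime u' v" "real n \<le> exp 1 * real m"
        by (auto simp: perfect_power_partners_def)
      have "u' = u" using uv(1) u g power_eq_iff_eq_base[of g u' u] by simp
      \<comment> \<open>Since e < 4 and \<open>g\<close> is at least 2, the factor e is below
        \<open>2 ^ g\<close>, so after taking g-th roots it costs less than a factor 2.\<close>
      have "real (v ^ g) < real ((2 * u) ^ g)"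
      proof -
        have "real (v ^ g) \<le> exp 1 * real (u ^ g)" using uv u by simp
        also have "\<dots> < 2 ^ 2 * real (u ^ g)" using exp_le u2 by (intro mult_strict_right_mono) auto
        also have "\<dots> \<le> 2 ^ g * real (u ^ g)" using g by (intro mult_right_mono power_increasing) auto
        finally show ?thesis by (simp add: power_mult_distrib)
      qed
      then have "v ^ g < (2 * u) ^ g" by (simp only: of_nat_less_iff)
      then have "v < 2 * u" by (rule power_less_imp_less_base) simp
      then show "n \<in> (\<lambda>v. v ^ g) ` V" using uv \<open>u' = u\<close> by (auto simp: V_def)
    qed
    have "finite V" by (simp add: V_def)
    then have fin: "finite (perfect_power_partners g m)" using sub finite_surj by blast
    have "card (perfect_power_partners g m) \<le> card V"
      using sub \<open>finite V\<close> by (rule surj_card_le[rotated])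
    also have "\<dots> \<le> 2 * totient u" unfolding V_def using u2 by (intro card_coprime_below_double) simp
    finally have "real (card (perfect_power_partners g m)) \<le> 2 * real (totient u)" by simp
    also have "real (totient u) = totient m / real (u ^ (g - 1))"
      using u2 g by (simp add: u totient_power)
    also have "2 * \<dots> \<le> 2 * (totient m / (sqrt m * sqrt 2 ^ (g - 2)))"
    proof (intro mult_left_mono divide_left_mono)
      \<comment> \<open>The square of \<open>u ^ (g - 1)\<close> is \<open>m * u ^ (g - 2)\<close>:
        one part gives \<open>sqrt m\<close>, the surplus gives geometric decay because
        \<open>u\<close> is at least 2.\<close>
      have "real m * 2 ^ (g - 2) \<le> real (u ^ (g - 1)) ^ 2"
      proof -
        have "real m * 2 ^ (g - 2) \<le> real u ^ g * real u ^ (g - 2)"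
          unfolding u using u2 by (auto intro!: mult_left_mono power_mono)
        also have "\<dots> = real (u ^ (g - 1)) ^ 2"
        proof -
          have "g + (g - 2) = (g - 1) * 2" using g by simp
          then show ?thesis by (simp only: of_nat_power flip: power_add power_mult)
        qed
        finally show ?thesis .
      qed
      then have "sqrt (real m * 2 ^ (g - 2)) \<le> real (u ^ (g - 1))" by (intro real_le_lsqrt) auto
      then show "sqrt m * sqrt 2 ^ (g - 2) \<le> real (u ^ (g - 1))"
        by (simp add: real_sqrt_mult real_sqrt_power)
    qed (use m u2 in auto)
    also have "\<dots> = 4 * (1 / sqrt 2) ^ g * (totient m / sqrt m)"
    proof -
      have "sqrt 2 ^ g = sqrt 2 ^ (g - 2) * 2"
        using g by (metis le_add_diff_inverse2 power_add real_sqrt_pow2 zero_le_numeral)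
      then show ?thesis using m by (simp add: power_one_over field_simps)
    qed
    finally show ?thesis using fin by blast
  qed
  then show "finite (perfect_power_partners g m)"
    "real (card (perfect_power_partners g m)) \<le> 4 * (1 / sqrt 2) ^ g * (totient m / sqrt m)" by auto
qed

text \<open>In the product formula the primes of \<open>g\<close> that do not divide
  \<open>k\<close> contribute factors at most 1.\<close>

lemma totient_mult_le:
  assumes "k > 0"
  shows "totient (k * g) \<le> g * totient k"
proof (cases "g = 0")
  case False
  define f where "f = (\<lambda>p::nat. 1 - 1 / real p)"
  have f: "0 \<le> f p" "f p \<le> 1" if "p \<in> prime_factors n" for p n
    using that prime_ge_1_nat[of p] by (auto simp: f_def in_prime_factors_iff)
  have "prime_factors k \<subseteq> prime_factors (k * g)"
    using assms False by (auto simp: in_prime_factors_iff)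
  then have "(\<Prod>p\<in>prime_factors (k * g). f p)
      = (\<Prod>p\<in>prime_factors (k * g) - prime_factors k. f p) * (\<Prod>p\<in>prime_factors k. f p)"
    by (intro prod.subset_diff) auto
  also have "\<dots> \<le> 1 * (\<Prod>p\<in>prime_factors k. f p)"
    by (intro mult_right_mono prod_le_1 prod_nonneg) (auto intro!: f)
  finally have "real (k * g) * (\<Prod>p\<in>prime_factors (k * g). f p)
      \<le> real (k * g) * (1 * (\<Prod>p\<in>prime_factors k. f p))"
    by (rule mult_left_mono) simp
  then have "real (totient (k * g)) \<le> real g * real (totient k)"
    unfolding totient_formula2 f_def by (simp add: mult_ac)
  then show ?thesis by (metis of_nat_le_iff of_nat_mult)
qed simp

text \<open>The right-hand side is the derivative of the geometric series at 1 / sqrt 2; passing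
  from weight \<open>g\<close> to \<open>Suc g\<close> only enlarges the terms.\<close>

lemma sum_weighted_geometric_le:
  assumes "finite G"
  shows "(\<Sum>g\<in>G. real g * (1 / sqrt 2) ^ g) \<le> 1 / (1 - 1 / sqrt 2) ^ 2"
proof -
  have t: "norm (1 / sqrt 2) < (1::real)" by (simp add: field_simps)
  have s: "(\<lambda>n. real (Suc n) * (1 / sqrt 2) ^ n) sums (1 / (1 - 1 / sqrt 2) ^ 2)"
    using geometric_deriv_sums[OF t] by simp
  have "(\<Sum>g\<in>G. real g * (1 / sqrt 2) ^ g) \<le> (\<Sum>g\<in>G. real (Suc g) * (1 / sqrt 2) ^ g)"
    by (intro sum_mono mult_right_mono) auto
  also have "\<dots> \<le> (\<Sum>n. real (Suc n) * (1 / sqrt 2) ^ n)"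
    using assms by (intro sum_le_suminf sums_summable[OF s]) auto
  finally show ?thesis using sums_unique[OF s] by simp
qed

text \<open>From 4 on, \<open>g ^ 2\<close> is at most \<open>2 ^ g\<close>, hence at most
  \<open>k * g\<close>, which gives g at most k; the 3 covers smaller \<open>g\<close>. This
  confines the exceptional exponents to a finite range.\<close>

lemma exponent_le_of_perfect_power:
  assumes "u ^ g = k * g" "u > 1" "k > 0"
  shows "g \<le> k + 3"
proof (cases "g \<ge> 4")
  case True
  have "g ^ 2 \<le> 2 ^ g" using True
  proof (induction g rule: dec_induct)
    case (step n)
    have "4 * n \<le> n * n" using step(1) by (intro mult_right_mono) auto
    then have "n + n + 1 \<le> n * n" using step(1) by linarith
    then have "Suc n ^ 2 \<le> 2 * n ^ 2" by (simp add: power2_eq_square)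
    also have "\<dots> \<le> 2 * 2 ^ n" using step by simp
    finally show ?case by simp
  qed simp
  also have "2 ^ g \<le> u ^ g" using assms(2) by (intro power_mono) auto
  finally have "g * g \<le> k * g" using assms(1) by (simp add: power2_eq_square)
  then show ?thesis using True by simp
qed simp

text \<open>Both inclusions use that the order divides the numerator. A pair of order k has
  numerator \<open>k * g\<close>; a pair (k, n) of another order has order j with
  \<open>k = j * g\<close>. In either case \<open>g\<close> different from 1 forces both entries to
  be g-th powers.\<close>

lemma ratio_pairs_exceptional:
  assumes k: "k > 1"
  defines "S \<equiv> {n. n > 0 \<and> coprime n k \<and> real n \<le> exp 1 * real k \<and> real k \<le> exp 1 * real n}"
  shows "ratio_pairs k \<subseteq> Pair k ` S \<union> (\<Union>g\<in>{2..k+3}. Pair (k * g) ` perfect_power_partners g (k * g))"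
    and "S \<subseteq> {n. (k, n) \<in> ratio_pairs k} \<union> (\<Union>g\<in>{2..k}. perfect_power_partners g k)"
proof -
  show "ratio_pairs k \<subseteq> Pair k ` S \<union> (\<Union>g\<in>{2..k+3}. Pair (k * g) ` perfect_power_partners g (k * g))"
  proof (rule subsetI, clarify)
    fix m n assume mn: "(m, n) \<in> ratio_pairs k"
      "(m, n) \<notin> (\<Union>g\<in>{2..k+3}. Pair (k * g) ` perfect_power_partners g (k * g))"
    then have *: "m > 0" "n > 0" "coprime m n" "real n \<le> exp 1 * real m" "real m \<le> exp 1 * real n"
      and ord: "alg_ord (root_of_ratio (m, n)) = enat k" by (auto simp: ratio_pairs_def)
    have pos: "root_of_ratio (m, n) \<noteq> 0" using root_of_ratio_pos[OF *(1,2)] by simp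
    have "k dvd m"
      by (rule alg_ord_dvd[OF ord pos]) (simp add: root_of_ratio_power *)
    then obtain g where g: "m = k * g" by blast
    have "root_of_ratio (m, n) ^ k \<in> \<rat>" using ord by (simp add: alg_ord_eq_enat_iff)
    from root_of_ratio_perfect_power[OF *(3,1,2) this g] obtain u v where
      uv: "m = u ^ g" "n = v ^ g" "coprime u v" by blast
    have "g = 1"
    proof (rule ccontr)
      assume "g \<noteq> 1"
      then have g2: "g \<ge> 2" using g *(1) by (cases g) auto
      have "u > 1"
      proof (rule ccontr)
        assume "\<not> u > 1"
        then have "m \<le> 1" using uv(1) power_le_one[of u g] by simp
        moreover have "k * 1 \<le> k * g" using g2 by (intro mult_le_mono) auto
        ultimately show False using g k by simp
      qed
      then have "g \<le> k + 3" using exponent_le_of_perfect_power[of u g k] uv(1) g k by simp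
      moreover have "n \<in> perfect_power_partners g (k * g)"
        using uv * g by (auto simp: perfect_power_partners_def)
      ultimately show False using mn(2) g g2 by auto
    qed
    then show "(m, n) \<in> Pair k ` S" using * g by (auto simp: S_def coprime_commute)
  qed
  show "S \<subseteq> {n. (k, n) \<in> ratio_pairs k} \<union> (\<Union>g\<in>{2..k}. perfect_power_partners g k)"
  proof
    fix n assume "n \<in> S"
    then have *: "n > 0" "coprime k n" "real n \<le> exp 1 * real k" "real k \<le> exp 1 * real n"
      by (auto simp: S_def coprime_commute)
    have k0: "k > 0" using k by simp
    define A where "A = root_of_ratio (k, n)"
    have A: "A ^ k \<in> \<rat>" "A \<noteq> 0"
      using root_of_ratio_power[OF k0 *(1)] root_of_ratio_pos[OF k0 *(1)] by (simp_all add: A_def)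
    define j where "j = (LEAST n. n \<ge> 1 \<and> A ^ n \<in> \<rat>)"
    have ord: "alg_ord A = enat j"
      using A(1) k unfolding alg_ord_def j_def by (auto intro!: exI[of _ k])
    have "j dvd k" by (rule alg_ord_dvd[OF ord A(2,1)])
    then obtain g where g: "k = j * g" by blast
    show "n \<in> {n. (k, n) \<in> ratio_pairs k} \<union> (\<Union>g\<in>{2..k}. perfect_power_partners g k)"
    proof (cases "g = 1")
      case True
      then have "(k, n) \<in> ratio_pairs k"
        using * ord g k0 by (simp add: ratio_pairs_def A_def)
      then show ?thesis by simp
    next
      case False
      have "g \<noteq> 0" "j \<ge> 1" using g k0 by (auto intro: Suc_leI gr0I)
      then have g2: "g \<ge> 2" "g \<le> k" using False mult_le_mono1[of 1 j g] g by auto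
      have "A ^ j \<in> \<rat>" using ord by (simp add: alg_ord_eq_enat_iff)
      from root_of_ratio_perfect_power[OF *(2) k0 *(1) this[unfolded A_def] g]
      have "n \<in> perfect_power_partners g k" using * by (auto simp: perfect_power_partners_def)
      then show ?thesis using g2 by auto
    qed
  qed
qed

lemma Q_minus_card_le:
  assumes k: "k > 1"
  defines "S \<equiv> {n. n > 0 \<and> coprime n k \<and> real n \<le> exp 1 * real k \<and> real k \<le> exp 1 * real n}"
  shows "\<bar>real (Q k) - real (card S)\<bar> \<le> 4 / (1 - 1 / sqrt 2) ^ 2 * (totient k / sqrt k)"
proof -
  define B where "B = (\<lambda>g. Pair (k * g) ` perfect_power_partners g (k * g))"
  have finS: "finite S"
    by (rule finite_subset[OF _ finite_nat_real_le[of "exp 1 * real k" "\<lambda>_. True"]]) (auto simp: S_def)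
  have card_B: "finite (B g)"
    "real (card (B g)) \<le> 4 * (totient k / sqrt k) * (real g * (1 / sqrt 2) ^ g)" if "g \<ge> 2" for g
  proof -
    have "k * 1 \<le> k * g" using that by (intro mult_le_mono) auto
    then have kg: "k * g > 1" using k by linarith
    show "finite (B g)" using card_perfect_power_partners(1)[OF kg that] by (simp add: B_def)
    have "real (card (B g)) \<le> 4 * (1 / sqrt 2) ^ g * (totient (k * g) / sqrt (k * g))"
      using card_perfect_power_partners(2)[OF kg that] by (simp add: B_def card_image inj_on_def)
    also have "\<dots> \<le> 4 * (1 / sqrt 2) ^ g * ((real g * totient k) / sqrt k)"
    proof (intro mult_left_mono frac_le)
      show "real (totient (k * g)) \<le> real g * totient k"
        using totient_mult_le[of k g] k of_nat_mono[of "totient (k * g)" "g * totient k"] by simp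
    qed (use k that in auto)
    finally show "real (card (B g)) \<le> 4 * (totient k / sqrt k) * (real g * (1 / sqrt 2) ^ g)"
      by (simp add: mult_ac)
  qed
  define D where "D = perfect_power_partners"
  have card_D: "finite (D g k)"
    "real (card (D g k)) \<le> 4 * (totient k / sqrt k) * (real g * (1 / sqrt 2) ^ g)" if "g \<ge> 2" for g
  proof -
    show "finite (D g k)" using card_perfect_power_partners(1)[OF k that] by (simp add: D_def)
    have "real (card (D g k)) \<le> 4 * (totient k / sqrt k) * (1 * (1 / sqrt 2) ^ g)"
      using card_perfect_power_partners(2)[OF k that] by (simp add: D_def mult_ac)
    \<comment> \<open>The additional factor \<open>g\<close> puts this family under the same weights
      as \<open>B\<close>, so one summation serves both.\<close>
    also have "\<dots> \<le> 4 * (totient k / sqrt k) * (real g * (1 / sqrt 2) ^ g)"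
      using that by (intro mult_left_mono mult_right_mono) auto
    finally show "real (card (D g k)) \<le> 4 * (totient k / sqrt k) * (real g * (1 / sqrt 2) ^ g)" .
  qed
  define K where "K = 4 / (1 - 1 / sqrt 2) ^ 2 * (totient k / sqrt k)"
  have union: "real (card (\<Union>g\<in>G. X g)) \<le> K"
    if "finite G" "\<And>g. g \<in> G \<Longrightarrow> real (card (X g)) \<le> 4 * (totient k / sqrt k) * (real g * (1 / sqrt 2) ^ g)"
    for G and X :: "nat \<Rightarrow> 'x set"
  proof -
    have "real (card (\<Union>g\<in>G. X g)) \<le> (\<Sum>g\<in>G. real (card (X g)))"
      using card_UN_le[OF that(1), of X] by (metis of_nat_le_iff of_nat_sum)
    also have "\<dots> \<le> 4 * (totient k / sqrt k) * (\<Sum>g\<in>G. real g * (1 / sqrt 2) ^ g)"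
      unfolding sum_distrib_left using that(2) by (rule sum_mono)
    also have "\<dots> \<le> 4 * (totient k / sqrt k) * (1 / (1 - 1 / sqrt 2) ^ 2)"
      using sum_weighted_geometric_le[OF that(1)] by (intro mult_left_mono) auto
    finally show ?thesis by (simp add: K_def mult_ac)
  qed
  note sub = ratio_pairs_exceptional[OF k, folded S_def]
  have finU: "finite (Pair k ` S \<union> (\<Union>g\<in>{2..k+3}. B g))" using finS card_B(1) by auto
  have "finite (ratio_pairs k)" using sub(1) finU unfolding B_def by (rule finite_subset)
  have "card (ratio_pairs k) \<le> card (Pair k ` S \<union> (\<Union>g\<in>{2..k+3}. B g))"
    using finU sub(1) unfolding B_def by (rule card_mono)
  also have "\<dots> \<le> card (Pair k ` S) + card (\<Union>g\<in>{2..k+3}. B g)" by (rule card_Un_le)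
  also have "card (Pair k ` S) = card S" by (simp add: card_image inj_on_def)
  finally have "card (ratio_pairs k) \<le> card S + card (\<Union>g\<in>{2..k+3}. B g)" .
  moreover have "real (card (\<Union>g\<in>{2..k+3}. B g)) \<le> K"
    using card_B(2) by (intro union) auto
  moreover have "card S \<le> card (ratio_pairs k) + card (\<Union>g\<in>{2..k}. D g k)"
  proof -
    have fin1: "finite {n. (k, n) \<in> ratio_pairs k}"
      using \<open>finite (ratio_pairs k)\<close> by (rule finite_surj[of _ _ snd]) force
    have "card S \<le> card ({n. (k, n) \<in> ratio_pairs k} \<union> (\<Union>g\<in>{2..k}. D g k))"
      using sub(2) fin1 card_D(1) unfolding D_def by (intro card_mono) auto
    also have "\<dots> \<le> card {n. (k, n) \<in> ratio_pairs k} + card (\<Union>g\<in>{2..k}. D g k)"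
      by (rule card_Un_le)
    also have "card {n. (k, n) \<in> ratio_pairs k} \<le> card (ratio_pairs k)"
      using \<open>finite (ratio_pairs k)\<close> by (intro card_inj_on_le[of "Pair k"]) (auto simp: inj_on_def)
    finally show ?thesis by simp
  qed
  moreover have "real (card (\<Union>g\<in>{2..k}. D g k)) \<le> K"
    using card_D(2) by (intro union) auto
  ultimately show ?thesis
    using Q_eq_card_ratio_pairs[of k] k unfolding K_def[symmetric] by linarith
qed

theorem theorem2p3:
  shows "(\<exists>C::real. \<forall>k::nat. k \<ge> 3 \<longrightarrow>
            \<bar>real (Q k) / real (totient k) - (exp 1 - 1 / exp 1)\<bar>
              \<le> C * (ln (ln (real k)) / sqrt (real k)))
         \<and> ((\<lambda>k. real (Q k) / real (totient k)) \<longlonglongrightarrow> exp 1 - 1 / exp 1)"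
proof -
  \<comment> \<open>The first summand comes from the exceptional pairs, the second from three sieve
    errors \<open>2 ^ card (prime_factors k)\<close>.\<close>
  define K where "K = 4 / (1 - 1 / sqrt 2) ^ 2 + 3 * 4 ^ 7"
  define c where "c = (exp 1 - 1 / exp 1 :: real)"
  have main: "\<bar>real (Q k) / real (totient k) - c\<bar> \<le> K / sqrt (real k)" if k: "k > 1" for k
  proof -
    have t: "real (totient k) > 0" using k by simp
    have "2 ^ card (prime_factors k) \<le> 4 ^ 7 * (totient k / sqrt (real k))"
      using two_power_omega_le[of k] k by (simp add: field_simps)
    then have "\<bar>real (Q k) - c * totient k\<bar> \<le> K * (totient k / sqrt (real k))"
      using Q_minus_card_le[OF k] card_coprime_ratio_range[OF k]
      unfolding K_def c_def distrib_right by linarith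
    then have "\<bar>real (Q k) - c * totient k\<bar> / totient k \<le> K * (totient k / sqrt (real k)) / totient k"
      using t by (intro divide_right_mono) auto
    moreover have "\<bar>real (Q k) - c * totient k\<bar> / totient k = \<bar>real (Q k) / totient k - c\<bar>"
    proof -
      have "real (Q k) / totient k - c = (real (Q k) - c * totient k) / totient k"
        using t by (simp add: field_simps)
      then show ?thesis by simp
    qed
    ultimately show ?thesis using t by simp
  qed
  have "K \<ge> 0" by (simp add: K_def)
  \<comment> \<open>For k at least 3 the double logarithm is at least \<open>l\<close>, so a bound
    \<open>K / sqrt k\<close> gives the stated one with constant \<open>K / l\<close>. That
    \<open>l\<close> is positive amounts to e < 3.\<close>
  define l where "l = ln (ln (3::real))"
  have "exp 1 < (3::real)"
  proof -
    have "exp 1 = exp (1 / 4 :: real) ^ 4" by (simp flip: exp_of_nat_mult)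
    also have "\<dots> \<le> (1 + 1 / 4 + (1 / 4)\<^sup>2) ^ 4" by (intro power_mono exp_bound) auto
    also have "\<dots> < 3" by (simp add: eval_nat_numeral)
    finally show ?thesis .
  qed
  then have ln3: "ln (3::real) > 1" by (metis exp_gt_zero ln_exp ln_less_cancel_iff zero_less_numeral)
  then have l: "l > 0" by (simp add: l_def)
  have "\<bar>real (Q k) / real (totient k) - c\<bar> \<le> K / l * (ln (ln (real k)) / sqrt (real k))" if "k \<ge> 3" for k
  proof -
    have "ln 3 \<le> ln (real k)" using that by simp
    then have "l \<le> ln (ln (real k))" unfolding l_def using ln3 that by (subst ln_le_cancel_iff) auto
    then have "K / sqrt (real k) * 1 \<le> K / sqrt (real k) * (ln (ln (real k)) / l)"
      using l \<open>K \<ge> 0\<close> by (intro mult_left_mono) auto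
    with main[of k] that show ?thesis by (simp add: mult_ac)
  qed
  moreover have "(\<lambda>k. real (Q k) / real (totient k)) \<longlonglongrightarrow> c"
  proof (rule LIM_zero_cancel, rule tendsto_0_le[where K = 1])
    show "(\<lambda>k. K / sqrt (real k)) \<longlonglongrightarrow> 0" by real_asymp
    show "\<forall>\<^sub>F k in sequentially. norm (real (Q k) / real (totient k) - c) \<le> norm (K / sqrt (real k)) * 1"
      by (rule eventually_mono[OF eventually_gt_at_top[of 1]]) (use main \<open>K \<ge> 0\<close> in simp)
  qed
  ultimately show ?thesis unfolding c_def by blast
qed

end
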